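(* Let $k$ be a knot whose determinant is a prime number $p$, and let $\mathcal{D}$ be a reduced, alternating diagram of $k$. Then every non-trivial $p$-coloring of $\mathcal{D}$ assigns different colors to different arcs (that is, any two distinct arcs of $\mathcal{D}$ receive different colors).
   Context: A diagram of a knot is a planar representation (regular projection) of the knot with gaps left to show where the knot crosses under itself; its arcs are the connected pieces from one undercrossing to the next. A diagram is alternating if, travelling along the knot, over- and undercrossings alternate. A diagram is reduced if it has no nugatory crossings (a crossing is nugatory if there is a simple closed curve in the projection plane or sphere meeting the diagram only at that crossing, transversally). For an integer $p>1$, a (Fox) $p$-coloring of a diagram $\mathcal{D}$ is an assignment of elements of $\{0,1,\dots,p-1\}$ (colors) to the arcs of $\mathcal{D}$ such that at every crossing $2x-y-z\equiv 0 \pmod p$, where $x$ is the color of the over arc and $y,z$ are the colors of the two under arcs. A $p$-coloring is trivial if all arcs receive the same color, and non-trivial otherwise. The determinant of $k$ is the knot invariant $\det k=|\Delta_k(-1)|$, where $\Delta_k$ is the Alexander polynomial. Equivalently, if a diagram with $n\ge 1$ crossings and $n$ arcs has $n\times n$ crossing matrix $C'$ (row $i$ lists the coefficients of the expression $2x-y-z$ at the $i$-th crossing, with columns indexed by arcs), then $\det k$ is the absolute value of the determinant of any $(n-1)\times(n-1)$ matrix obtained from $C'$ by deleting one row and one column. *)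

theory Defs
  imports
    "HOL-Analysis.Analysis"
    "HOL-Number_Theory.Cong"
    "Jordan_Normal_Form.Determinant"
begin

text \<open>
  Space is modelled as \<open>complex \<times> real\<close>: the first component is the projection plane and the
  second one the height above it.  A knot is parametrized by the real line with period 1, so
  that no base point is singled out and derivatives make sense at every parameter.
\<close>

type_synonym space = "complex \<times> real"

definition knot :: "(real \<Rightarrow> space) \<Rightarrow> bool" where
  "knot K \<longleftrightarrow> continuous_on UNIV K \<and> (\<forall>s t. K s = K t \<longleftrightarrow> s - t \<in> \<int>)"

definition shadow :: "(real \<Rightarrow> space) \<Rightarrow> real \<Rightarrow> complex" where
  "shadow K t = fst (K t)"

definition height :: "(real \<Rightarrow> space) \<Rightarrow> real \<Rightarrow> real" where
  "height K t = snd (K t)"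

definition under_params :: "(real \<Rightarrow> space) \<Rightarrow> real set" where
  "under_params K = {t. \<exists>s. shadow K s = shadow K t \<and> height K t < height K s}"

definition over_params :: "(real \<Rightarrow> space) \<Rightarrow> real set" where
  "over_params K = {t. \<exists>s. shadow K s = shadow K t \<and> height K s < height K t}"

definition crossing_params :: "(real \<Rightarrow> space) \<Rightarrow> real set" where
  "crossing_params K = {t. \<exists>s. s - t \<notin> \<int> \<and> shadow K s = shadow K t}"

text \<open>
  Finitely many multiple points, each of them a transverse double point.  Differentiability is
  only needed where strands cross, so that smooth and polygonal knots are both covered.
  The condition \<open>\<not> collinear {0, v, w}\<close> is linear independence of \<open>v\<close> and \<open>w\<close> over the reals.
\<close>

definition regular_projection :: "(real \<Rightarrow> space) \<Rightarrow> bool" where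
  "regular_projection K \<longleftrightarrow>
     finite (crossing_params K \<inter> {0..<1}) \<and>
     (\<forall>r s t. shadow K r = shadow K s \<and> shadow K s = shadow K t \<longrightarrow>
        r - s \<in> \<int> \<or> s - t \<in> \<int> \<or> r - t \<in> \<int>) \<and>
     (\<forall>s t. shadow K s = shadow K t \<and> s - t \<notin> \<int> \<longrightarrow>
        (\<exists>v w. (shadow K has_vector_derivative v) (at s) \<and>
               (shadow K has_vector_derivative w) (at t) \<and>
               \<not> collinear {0, v, w}))"

text \<open>Whenever \<open>s < t\<close> are consecutive crossing parameters, exactly one of them is an
  undercrossing.\<close>

definition alternating :: "(real \<Rightarrow> space) \<Rightarrow> bool" where
  "alternating K \<longleftrightarrow>
     (\<forall>s\<in>crossing_params K. \<forall>t\<in>crossing_params K.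
        s < t \<and> crossing_params K \<inter> {s<..<t} = {} \<longrightarrow>
        (s \<in> under_params K \<longleftrightarrow> t \<in> over_params K))"

text \<open>
  The simple closed curve lives in the plane; curves on the sphere give nothing more, since a
  curve through the point at infinity can be pushed off it away from the diagram.  Transversality
  means that the curve has at the crossing \<open>z\<close> a tangent vector that is not parallel to either
  strand.  Requiring \<open>0 < r < 1\<close> only says that the curve is not based at \<open>z\<close>.
\<close>

definition nugatory :: "(real \<Rightarrow> space) \<Rightarrow> complex \<Rightarrow> bool" where
  "nugatory K z \<longleftrightarrow>
     (\<exists>J r v. simple_path J \<and> pathfinish J = pathstart J \<and>
        path_image J \<inter> range (shadow K) = {z} \<and>
        0 < r \<and> r < 1 \<and> J r = z \<and> (J has_vector_derivative v) (at r) \<and>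
        (\<forall>t w. shadow K t = z \<and> (shadow K has_vector_derivative w) (at t) \<longrightarrow>
           \<not> collinear {0, v, w}))"

definition reduced_diagram :: "(real \<Rightarrow> space) \<Rightarrow> bool" where
  "reduced_diagram K \<longleftrightarrow> (\<forall>z \<in> shadow K ` crossing_params K. \<not> nugatory K z)"

definition num_crossings :: "(real \<Rightarrow> space) \<Rightarrow> nat" where
  "num_crossings K = card (under_params K \<inter> {0..<1})"

text \<open>
  The undercrossings in order along the knot: for \<open>n > 0\<close> crossings, \<open>under_param K 0 < \<dots> <
  under_param K (n - 1)\<close> are those in \<open>{0..<1}\<close>, and \<open>under_param K (i + n) = under_param K i + 1\<close>.
  Crossing \<open>i < n\<close> is the one whose undercrossing is at \<open>under_param K i\<close>.
\<close>

definition under_param :: "(real \<Rightarrow> space) \<Rightarrow> nat \<Rightarrow> real" where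
  "under_param K i =
     sorted_list_of_set (under_params K \<inter> {0..<1}) ! (i mod num_crossings K)
       + real (i div num_crossings K)"

definition over_param :: "(real \<Rightarrow> space) \<Rightarrow> nat \<Rightarrow> real" where
  "over_param K i =
     (THE s. s \<in> {0..<1} \<and> shadow K s = shadow K (under_param K i) \<and>
             height K (under_param K i) < height K s)"

text \<open>
  Arcs are recorded as the pieces of the knot in space lying above them.  A diagram without
  crossings has a single arc, the whole knot.
\<close>

definition diagram_arc :: "(real \<Rightarrow> space) \<Rightarrow> nat \<Rightarrow> space set" where
  "diagram_arc K i = K ` {under_param K i <..< under_param K (Suc i)}"

definition arcs :: "(real \<Rightarrow> space) \<Rightarrow> space set set" where
  "arcs K = (if num_crossings K = 0 then {range K} else diagram_arc K ` {..<num_crossings K})"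

definition over_arc :: "(real \<Rightarrow> space) \<Rightarrow> nat \<Rightarrow> nat" where
  "over_arc K i = (THE j. j < num_crossings K \<and> K (over_param K i) \<in> diagram_arc K j)"

text \<open>The arc that ends at the undercrossing of crossing \<open>i\<close>; the other under arc, \<open>diagram_arc K i\<close>,
  starts there.\<close>

definition in_arc :: "(real \<Rightarrow> space) \<Rightarrow> nat \<Rightarrow> nat" where
  "in_arc K i = (i + num_crossings K - 1) mod num_crossings K"

text \<open>Coefficients add up when some of the three arcs at a crossing coincide.\<close>

definition crossing_matrix :: "(real \<Rightarrow> space) \<Rightarrow> int mat" where
  "crossing_matrix K = Matrix.mat (num_crossings K) (num_crossings K)
     (\<lambda>(i, j). 2 * of_bool (j = over_arc K i) - of_bool (j = i) - of_bool (j = in_arc K i))"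

text \<open>
  The determinant of a knot, computed from its projection; the choice of the deleted row and
  column does not matter.  Without crossings this is the empty determinant 1, the determinant of
  the unknot.
\<close>

definition knot_det :: "(real \<Rightarrow> space) \<Rightarrow> int" where
  "knot_det K = \<bar>Determinant.det (mat_delete (crossing_matrix K) 0 0)\<bar>"

definition coloring :: "nat \<Rightarrow> (real \<Rightarrow> space) \<Rightarrow> (space set \<Rightarrow> nat) \<Rightarrow> bool" where
  "coloring p K c \<longleftrightarrow>
     (\<forall>A\<in>arcs K. c A \<in> {0..<p}) \<and>
     (\<forall>i<num_crossings K.
        [2 * int (c (diagram_arc K (over_arc K i)))
           - int (c (diagram_arc K i)) - int (c (diagram_arc K (in_arc K i))) = 0]
          (mod int p))"

definition trivial_coloring :: "(real \<Rightarrow> space) \<Rightarrow> (space set \<Rightarrow> nat) \<Rightarrow> bool" where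
  "trivial_coloring K c \<longleftrightarrow> (\<forall>A\<in>arcs K. \<forall>B\<in>arcs K. c A = c B)"

end

theory Submission imports Defs begin

text \<open>
  In an alternating diagram every arc is the over arc of exactly one crossing.  Let each crossing
  point to the two crossings at which its over arc ends; this is a digraph with in- and outdegree 2,
  and the crossing matrix is its Laplacian.  As the determinant is a prime \<open>p\<close>, the sum-zero integer
  vectors modulo the row lattice form a group of order \<open>p\<close>.  Hence colorings are unique up to
  affine maps, and if the arcs over \<open>i\<close> and \<open>j\<close> have equal colors, then the difference of their
  unit vectors is an integer combination \<open>u\<close> of rows.  By the maximum principle the set where
  \<open>u\<close> is maximal has a single outgoing edge and separates \<open>i\<close> from \<open>j\<close>.

  For any set \<open>T\<close> with a single outgoing edge, recoloring the complement of \<open>T\<close> by a constant gives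
  another coloring, so that by uniqueness the coloring is constant on \<open>T\<close> or on its complement.
  Submodularity of the number of outgoing edges shrinks such a set to a single crossing.  Its over
  arc ends at the crossing itself, so the diagram has a kink, and that crossing is nugatory.
\<close>

section \<open>Integer matrices with prime minor\<close>

text \<open>Each term of the Leibniz expansion has one factor from column \<open>a\<close> and one
  from column \<open>b\<close>.\<close>

lemma det_dvd_power2_if_two_columns:
  fixes M :: "int mat"
  assumes M: "M \<in> carrier_mat m m" and ab: "a < m" "b < m" "a \<noteq> b"
    and "\<And>i. i < m \<Longrightarrow> p dvd M $$ (i, a)" "\<And>i. i < m \<Longrightarrow> p dvd M $$ (i, b)"
  shows "p\<^sup>2 dvd Determinant.det M"
  unfolding det_col[OF M]
proof (intro dvd_sum dvd_mult)
  fix \<pi> assume "\<pi> \<in> {\<pi>. \<pi> permutes {0..<m}}"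
  then have \<pi>: "\<pi> j < m" if "j < m" for j using that permutes_in_image by fastforce
  have "(\<Prod>j<m. M $$ (\<pi> j, j)) = M $$ (\<pi> a, a) * (M $$ (\<pi> b, b) * (\<Prod>j\<in>{..<m} - {a} - {b}. M $$ (\<pi> j, j)))"
    using ab by (simp add: prod.remove[of "{..<m}" a] prod.remove[of "{..<m} - {a}" b])
  then show "p\<^sup>2 dvd (\<Prod>j<m. M $$ (\<pi> j, j))"
    using assms \<pi> by (simp add: power2_eq_square mult_dvd_mono)
qed

text \<open>Modulo \<open>p\<close>, a matrix of determinant \<open>p\<close> up to sign has a
  kernel of dimension one: Cramer's rule, applied to two independent null vectors, would make
  \<open>p * p\<close> divide the determinant times a factor prime to \<open>p\<close>.\<close>

lemma minors_of_null_vectors_mod_prime: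
  fixes M :: "int mat" and q r :: "int Matrix.vec"
  assumes M: "M \<in> carrier_mat m m" and "prime p" "\<bar>Determinant.det M\<bar> = p"
    and q: "q \<in> carrier_vec m" "\<And>i. i < m \<Longrightarrow> p dvd (M *\<^sub>v q) $ i"
    and r: "r \<in> carrier_vec m" "\<And>i. i < m \<Longrightarrow> p dvd (M *\<^sub>v r) $ i"
    and ab: "a < m" "b < m" and qa: "\<not> p dvd q $ a"
  shows "p dvd q $ a * r $ b - r $ a * q $ b"
proof (cases "a = b")
  case False
  \<comment> \<open>This combination of the null vectors vanishes at \<open>a\<close>, so that
    replacing column \<open>a\<close> of \<open>M\<close> does not affect its product with
    \<open>w\<close>.\<close>
  define w where "w = q $ a \<cdot>\<^sub>v r - r $ a \<cdot>\<^sub>v q"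
  have w: "w \<in> carrier_vec m" using q r by (simp add: w_def)
  have wa: "w $ a = 0" and wb: "w $ b = q $ a * r $ b - r $ a * q $ b"
    using q r ab by (simp_all add: w_def)
  define M1 where "M1 = replace_col M (M *\<^sub>v q) a"
  define M2 where "M2 = replace_col M1 (M1 *\<^sub>v w) b"
  have M1: "M1 \<in> carrier_mat m m" and M2: "M2 \<in> carrier_mat m m"
    using M by (auto simp: M1_def M2_def replace_col_def)
  have M1w: "M1 *\<^sub>v w = M *\<^sub>v w"
  proof
    fix i assume i: "i < dim_vec (M *\<^sub>v w)"
    show "(M1 *\<^sub>v w) $ i = (M *\<^sub>v w) $ i"
      using i M w wa by (auto simp: M1_def replace_col_def scalar_prod_def intro!: sum.cong)
  qed (use M M1 in auto)
  have "p dvd (M1 *\<^sub>v w) $ i" if i: "i < m" for i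
  proof -
    have row: "Matrix.row M i \<in> carrier_vec m" using M i by (intro carrier_vecI) simp
    have "Matrix.row M i \<bullet> w = q $ a * (Matrix.row M i \<bullet> r) - r $ a * (Matrix.row M i \<bullet> q)"
      unfolding w_def using row q(1) r(1) by (simp add: scalar_prod_minus_distrib[of _ m])
    then have "(M *\<^sub>v w) $ i = q $ a * (M *\<^sub>v r) $ i - r $ a * (M *\<^sub>v q) $ i" using M i by simp
    then show ?thesis unfolding M1w using q(2)[OF i] r(2)[OF i] by simp
  qed
  then have "p dvd M2 $$ (i, b)" if "i < m" for i
    using that M1 ab by (auto simp: M2_def replace_col_def)
  moreover have "p dvd M2 $$ (i, a)" if "i < m" for i
    using that M M1 ab False q(2)[OF that] by (auto simp: M2_def M1_def replace_col_def)
  ultimately have "p\<^sup>2 dvd Determinant.det M2"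
    using det_dvd_power2_if_two_columns[OF M2 ab False] by blast
  moreover have "Determinant.det M2 = w $ b * (q $ a * Determinant.det M)"
    unfolding M2_def cramer_lemma_mat[OF M1 w ab(2)] unfolding M1_def cramer_lemma_mat[OF M q(1) ab(1)] ..
  ultimately have "p * p dvd (w $ b * q $ a) * Determinant.det M" by (simp add: power2_eq_square mult.assoc)
  then have "p * p dvd \<bar>(w $ b * q $ a) * Determinant.det M\<bar>" by simp
  then have "p * p dvd \<bar>w $ b * q $ a\<bar> * p" using assms(3) by (simp only: abs_mult)
  then have "p dvd w $ b * q $ a" using \<open>prime p\<close> by auto
  then show ?thesis using \<open>prime p\<close> qa by (simp add: prime_dvd_mult_iff wb)
qed simp

section \<open>Null vectors and row lattice of a matrix with a prime minor\<close>

locale prime_minor =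
  fixes n :: nat and B :: "nat \<Rightarrow> nat \<Rightarrow> int" and p :: int
  assumes n_pos: "n > 0" and row_sum: "\<And>i. i < n \<Longrightarrow> (\<Sum>j<n. B i j) = 0"
    and prime_p: "prime p"
    and minor: "\<bar>Determinant.det (Matrix.mat (n - 1) (n - 1) (\<lambda>(i, j). B (Suc i) (Suc j)))\<bar> = p"
begin

definition M :: "int mat" where
  "M = Matrix.mat (n - 1) (n - 1) (\<lambda>(i, j). B (Suc i) (Suc j))"

text \<open>For the crossing matrix these are the Fox colorings, indexed by arcs and with arbitrary
  integers as representatives.\<close>

definition null_mod :: "(nat \<Rightarrow> int) \<Rightarrow> bool" where
  "null_mod x \<longleftrightarrow> (\<forall>i<n. p dvd (\<Sum>j<n. B i j * x j))"

lemma M: "M \<in> carrier_mat (n - 1) (n - 1)" by (simp add: M_def)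

lemma sum_split: "(\<Sum>j<n. h j) = h 0 + (\<Sum>j<n - 1. h (Suc j))" for h :: "nat \<Rightarrow> int"
  using sum.lessThan_Suc_shift[of h "n - 1"] n_pos by simp

text \<open>Rows sum to zero, so constants are null vectors. Subtracting the value at 0 removes this
  freedom and turns a null vector modulo \<open>p\<close> into one of the minor
  \<open>M\<close>.\<close>

definition reduced :: "(nat \<Rightarrow> int) \<Rightarrow> int Matrix.vec" where
  "reduced x = Matrix.vec (n - 1) (\<lambda>j. x (Suc j) - x 0)"

lemma reduced: "reduced x \<in> carrier_vec (n - 1)" by (simp add: reduced_def)

lemma mult_reduced:
  assumes "i < n - 1"
  shows "(M *\<^sub>v reduced x) $ i = (\<Sum>j<n. B (Suc i) j * x j)"
proof -
  have "(M *\<^sub>v reduced x) $ i = (\<Sum>j<n - 1. B (Suc i) (Suc j) * (x (Suc j) - x 0))"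
    using assms by (simp add: M_def reduced_def scalar_prod_def atLeast0LessThan)
  also have "\<dots> = (\<Sum>j<n. B (Suc i) j * (x j - x 0))" by (simp add: sum_split)
  also have "\<dots> = (\<Sum>j<n. B (Suc i) j * x j) - (\<Sum>j<n. B (Suc i) j) * x 0"
    by (simp add: right_diff_distrib sum_subtractf sum_distrib_right)
  finally show ?thesis using assms row_sum[of "Suc i"] by simp
qed

lemma null_mod_reduced: "null_mod x \<Longrightarrow> i < n - 1 \<Longrightarrow> p dvd (M *\<^sub>v reduced x) $ i"
  using mult_reduced[of i x] by (simp add: null_mod_def)

lemma nonconstant_index:
  assumes "a < n" "b < n" "\<not> p dvd x a - x b"
  obtains k where "k < n - 1" "\<not> p dvd reduced x $ k"
proof -
  have "\<exists>c. c < n \<and> \<not> p dvd x c - x 0"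
  proof (rule ccontr)
    assume "\<not> ?thesis"
    then have "p dvd x a - x 0" "p dvd x b - x 0" using assms by auto
    from dvd_diff[OF this] show False using assms(3) by simp
  qed
  then obtain c where c: "c < n" "\<not> p dvd x c - x 0" by blast
  then have "c \<noteq> 0" by (metis diff_self dvd_0_right)
  then have "c - 1 < n - 1" "\<not> p dvd reduced x $ (c - 1)" using c by (auto simp: reduced_def)
  then show ?thesis using that by blast
qed

text \<open>The reduced vectors lie in a one-dimensional kernel modulo \<open>p\<close>, hence are
  proportional; undoing the reduction contributes the constant \<open>\<mu>\<close>.\<close>

lemma null_mod_unique:
  assumes x: "null_mod x" and y: "null_mod y" and ab: "a < n" "b < n" "\<not> p dvd x a - x b"
  shows "\<exists>l \<mu>. \<forall>k<n. p dvd y k - (l * x k + \<mu>)"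
proof -
  obtain c where c: "c < n - 1" "\<not> p dvd reduced x $ c" using nonconstant_index[OF ab] .
  define X where "X k = x k - x 0" for k
  define Y where "Y k = y k - y 0" for k
  have minors: "p dvd X (Suc c) * Y k - Y (Suc c) * X k" if "k < n" for k
  proof (cases k)
    case (Suc j)
    then have j: "j < n - 1" using that by simp
    show ?thesis
      using minors_of_null_vectors_mod_prime[OF M prime_p minor[folded M_def] reduced null_mod_reduced[OF x]
        reduced null_mod_reduced[OF y] c(1) j c(2)] c(1) j Suc
      by (simp add: reduced_def X_def Y_def)
  qed (simp add: X_def Y_def)
  have "\<not> p dvd X (Suc c)" using c by (simp add: reduced_def X_def)
  then have "coprime (X (Suc c)) p"
    using prime_p by (simp add: prime_imp_coprime coprime_commute)
  \<comment> \<open>\<open>t\<close> inverts a nonzero entry of the reduced \<open>x\<close> modulo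
    \<open>p\<close>, which makes \<open>t * Y (Suc c)\<close> the factor of
    proportionality.\<close>
  then obtain t where "[X (Suc c) * t = 1] (mod p)" using cong_solve_coprime_int by blast
  then have t: "p dvd X (Suc c) * t - 1" by (simp add: cong_iff_dvd_diff)
  have "p dvd y k - (t * Y (Suc c) * x k + (y 0 - t * Y (Suc c) * x 0))" if "k < n" for k
  proof -
    have "y k - (t * Y (Suc c) * x k + (y 0 - t * Y (Suc c) * x 0)) =
        t * (X (Suc c) * Y k - Y (Suc c) * X k) - (X (Suc c) * t - 1) * Y k"
      by (simp add: X_def Y_def algebra_simps)
    then show ?thesis using minors[OF that] t by simp
  qed
  then show ?thesis by blast
qed

text \<open>Columns of the adjugate are null vectors modulo \<open>p\<close>, hence multiples of the
  reduced \<open>x\<close>. Pairing them with \<open>y\<close> therefore gives multiples of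
  \<open>p\<close>, so that solving for \<open>u\<close> by the adjugate leaves no
  denominators.\<close>

lemma row_span:
  assumes x: "null_mod x" and ab: "a < n" "b < n" "\<not> p dvd x a - x b"
    and y: "(\<Sum>j<n. y j) = 0" "p dvd (\<Sum>j<n. y j * x j)"
  shows "\<exists>u. \<forall>j<n. (\<Sum>i<n. u i * B i j) = y j"
proof -
  obtain c where c: "c < n - 1" "\<not> p dvd reduced x $ c" using nonconstant_index[OF ab] .
  let ?A = "adj_mat M" and ?d = "Determinant.det M"
  have A: "?A \<in> carrier_mat (n - 1) (n - 1)" using adj_mat(1)[OF M] .
  have "?d \<noteq> 0" using minor prime_p by (auto simp: M_def)
  have "p dvd ?d" using minor[folded M_def] by (metis abs_dvd_iff dvd_abs_iff dvd_refl)
  have "?d dvd p" using minor[folded M_def] by (metis abs_dvd_iff dvd_abs_iff dvd_refl)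
  \<comment> \<open>\<open>v\<close> is the row vector \<open>y\<close> times the adjugate; divided
    by the determinant it solves the system of the minor.\<close>
  define v where "v k = (\<Sum>j<n - 1. y (Suc j) * ?A $$ (j, k))" for k
  have "p dvd v k" if k: "k < n - 1" for k
  proof -
    have "M *\<^sub>v col ?A k = col (M * ?A) k" using M A k by (simp add: col_mult2)
    also have "\<dots> = col (?d \<cdot>\<^sub>m 1\<^sub>m (n - 1)) k" by (simp add: adj_mat(2)[OF M])
    finally have "p dvd (M *\<^sub>v col ?A k) $ i" if "i < n - 1" for i
      using that k \<open>p dvd ?d\<close> by auto
    moreover have "col ?A k \<in> carrier_vec (n - 1)" using A by (intro carrier_vecI) simp
    ultimately have minors: "p dvd reduced x $ c * col ?A k $ j - col ?A k $ c * reduced x $ j" if "j < n - 1" for j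
      using minors_of_null_vectors_mod_prime[OF M prime_p minor[folded M_def] reduced null_mod_reduced[OF x]
        _ _ c(1) that c(2), of "col ?A k"] by blast
    have "(\<Sum>j<n - 1. y (Suc j) * reduced x $ j) = (\<Sum>j<n. y j * (x j - x 0))"
      by (simp add: sum_split reduced_def)
    also have "\<dots> = (\<Sum>j<n. y j * x j) - (\<Sum>j<n. y j) * x 0"
      by (simp add: right_diff_distrib sum_subtractf sum_distrib_right)
    finally have yx: "p dvd (\<Sum>j<n - 1. y (Suc j) * reduced x $ j)" using y by simp
    have "reduced x $ c * v k = (\<Sum>j<n - 1. y (Suc j) * (reduced x $ c * col ?A k $ j - col ?A k $ c * reduced x $ j))
        + col ?A k $ c * (\<Sum>j<n - 1. y (Suc j) * reduced x $ j)"
      using A k c(1) by (simp add: v_def sum_distrib_left sum.distrib[symmetric] algebra_simps)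
    moreover have "p dvd \<dots>" by (rule dvd_add[OF dvd_sum[OF dvd_mult[OF minors]] dvd_mult[OF yx]]) simp
    ultimately have "p dvd reduced x $ c * v k" by (simp only:)
    then show ?thesis using c(2) prime_p by (simp add: prime_dvd_mult_iff)
  qed
  then have dv: "?d * (v k div ?d) = v k" if "k < n - 1" for k
    using that \<open>?d dvd p\<close> by (metis dvd_mult_div_cancel dvd_trans)
  \<comment> \<open>Row 0 is absent from the minor and gets coefficient 0; \<open>i - 1\<close>
    undoes the index shift.\<close>
  define u where "u i = (if i = 0 then 0 else v (i - 1) div ?d)" for i
  have col: "(\<Sum>i<n. u i * B i (Suc j)) = y (Suc j)" if j: "j < n - 1" for j
  proof -
    have "?d * (\<Sum>i<n. u i * B i (Suc j)) = (\<Sum>i<n - 1. ?d * (v i div ?d) * B (Suc i) (Suc j))"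
      by (simp add: sum_split u_def sum_distrib_left mult.assoc)
    also have "\<dots> = (\<Sum>i<n - 1. (\<Sum>l<n - 1. y (Suc l) * ?A $$ (l, i)) * M $$ (i, j))"
      using dv j by (intro sum.cong) (auto simp: M_def v_def)
    also have "\<dots> = (\<Sum>l<n - 1. y (Suc l) * (\<Sum>i<n - 1. ?A $$ (l, i) * M $$ (i, j)))"
      unfolding sum_distrib_left sum_distrib_right by (subst sum.swap) (simp add: mult.assoc)
    also have "\<dots> = (\<Sum>l<n - 1. y (Suc l) * (?A * M) $$ (l, j))"
      using A M j by (intro sum.cong) (auto simp: scalar_prod_def atLeast0LessThan)
    also have "\<dots> = (\<Sum>l<n - 1. if l = j then y (Suc l) * ?d else 0)"
      using j by (intro sum.cong) (auto simp: adj_mat(3)[OF M])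
    also have "\<dots> = ?d * y (Suc j)" using j by simp
    finally show ?thesis using \<open>?d \<noteq> 0\<close> by simp
  qed
  \<comment> \<open>Column 0 was deleted too; its equation follows because both sides sum to zero
    over all columns.\<close>
  have "(\<Sum>i<n. u i * B i 0) = y 0"
  proof -
    have "(\<Sum>j<n. \<Sum>i<n. u i * B i j) = (\<Sum>i<n. u i * (\<Sum>j<n. B i j))"
      unfolding sum_distrib_left by (rule sum.swap)
    also have "\<dots> = 0" using row_sum by simp
    finally have "(\<Sum>i<n. u i * B i 0) + (\<Sum>j<n - 1. y (Suc j)) = 0"
      using col by (simp add: sum_split[of "\<lambda>j. \<Sum>i<n. u i * B i j"])
    then show ?thesis using y(1) by (simp add: sum_split[of y])
  qed
  then have "(\<Sum>i<n. u i * B i j) = y j" if "j < n" for j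
    using col[of "j - 1"] that by (cases j) auto
  then show ?thesis by blast
qed

end

section \<open>Digraphs made of two permutations\<close>

locale permutation_digraph =
  fixes V :: "'a set" and f g :: "'a \<Rightarrow> 'a"
  assumes finite_V: "finite V" and f: "f permutes V" and g: "g permutes V"
    and connected: "\<And>S. S \<subseteq> V \<Longrightarrow> S \<noteq> {} \<Longrightarrow> f ` S \<subseteq> S \<Longrightarrow> g ` S \<subseteq> S \<Longrightarrow> S = V"
begin

abbreviation f' :: "'a \<Rightarrow> 'a" where "f' \<equiv> inv_into UNIV f"
abbreviation g' :: "'a \<Rightarrow> 'a" where "g' \<equiv> inv_into UNIV g"

text \<open>A sum of indicators over all of \<open>V\<close>, so that submodularity and the effect
  of complements can be checked term by term.\<close>

definition exits :: "('a \<Rightarrow> 'a) \<Rightarrow> 'a set \<Rightarrow> nat" where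
  "exits h S = (\<Sum>k\<in>V. of_bool (k \<in> S \<and> h k \<notin> S))"

definition outdeg :: "'a set \<Rightarrow> nat" where
  "outdeg S = exits f S + exits g S"

lemma exits_eq_card: "S \<subseteq> V \<Longrightarrow> exits h S = card {k \<in> S. h k \<notin> S}"
  using finite_V by (auto simp: exits_def sum.If_cases of_bool_def intro!: arg_cong[where f = card])

lemma exits_submodular: "exits h (S \<inter> T) + exits h (S \<union> T) \<le> exits h S + exits h T"
  unfolding exits_def sum.distrib[symmetric] by (rule sum_mono) auto

text \<open>A permutation sends as many elements of \<open>V\<close> into \<open>S\<close> as
  \<open>S\<close> contains, so equally many edges enter and leave \<open>S\<close>.\<close>

lemma exits_Compl:
  assumes "h permutes V"
  shows "exits h (V - S) = exits h S"
proof -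
  have "(\<Sum>k\<in>V. of_bool (h k \<in> S)) = (\<Sum>k\<in>V. of_bool (k \<in> S) :: nat)"
    using sum.permute[OF assms, of "\<lambda>k. of_bool (k \<in> S) :: nat"] unfolding o_def by (rule sym)
  moreover have "exits h (V - S) + (\<Sum>k\<in>V. of_bool (k \<in> S)) = exits h S + (\<Sum>k\<in>V. of_bool (h k \<in> S))"
    unfolding exits_def sum.distrib[symmetric]
    by (rule sum.cong) (use permutes_in_image[OF assms] in auto)
  ultimately show ?thesis by linarith
qed

lemma outdeg_submodular: "outdeg (S \<inter> T) + outdeg (S \<union> T) \<le> outdeg S + outdeg T"
  using exits_submodular[of f S T] exits_submodular[of g S T] by (simp add: outdeg_def)

lemma outdeg_Compl: "outdeg (V - S) = outdeg S"
  by (simp add: outdeg_def exits_Compl f g)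

lemma outdeg_pos:
  assumes "S \<subseteq> V" "S \<noteq> {}" "S \<noteq> V"
  shows "outdeg S > 0"
proof (rule ccontr)
  assume "\<not> outdeg S > 0"
  then have "\<forall>k\<in>S. f k \<in> S" "\<forall>k\<in>S. g k \<in> S"
    using assms(1) finite_V by (auto simp: outdeg_def exits_def sum_eq_0_iff split: if_splits)
  then show False using connected[of S] assms by blast
qed

text \<open>By connectedness the intersection and the union each have at least one exit, while
  submodularity allows two in total.\<close>

lemma uncross:
  assumes "S \<subseteq> V" "T \<subseteq> V" "outdeg S = 1" "outdeg T = 1" "S \<inter> T \<noteq> {}" "S \<union> T \<noteq> V"
  shows "outdeg (S \<inter> T) = 1"
proof -
  have "outdeg (S \<union> T) > 0" using assms by (intro outdeg_pos) auto
  moreover have "S \<inter> T \<noteq> V" using assms by auto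
  then have "outdeg (S \<inter> T) > 0" using assms by (intro outdeg_pos) auto
  ultimately show ?thesis using outdeg_submodular[of S T] assms by linarith
qed

text \<open>The set \<open>T\<close> is where \<open>u\<close> is maximal: at a maximum other than \<open>i\<close> both successors are again maximal,
  at \<open>i\<close> exactly one is, and \<open>j\<close> cannot be a maximum.\<close>

lemma level_set_of_potential:
  fixes u :: "'a \<Rightarrow> int"
  assumes ij: "i \<in> V" "j \<in> V" "i \<noteq> j"
    and u: "\<And>k. k \<in> V \<Longrightarrow> 2 * u k - u (f k) - u (g k) = of_bool (k = i) - of_bool (k = j)"
  obtains T where "T \<subseteq> V" "i \<in> T" "j \<notin> T" "outdeg T = 1"
proof -
  define m where "m = Max (u ` V)"
  define T where "T = {k \<in> V. u k = m}"
  have max: "u k \<le> m" if "k \<in> V" for k using that finite_V by (simp add: m_def)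
  have fV: "f k \<in> V" "g k \<in> V" if "k \<in> V" for k
    using that f g by (simp_all add: permutes_in_image)
  have "m \<in> u ` V" unfolding m_def using finite_V ij by (intro Max_in) auto
  then have "T \<noteq> {}" by (auto simp: T_def)
  have stay: "f k \<in> T" "g k \<in> T" if "k \<in> T" "k \<noteq> i" for k
  proof -
    have "u (f k) + u (g k) \<ge> 2 * m"
      using u[of k] that by (cases "k = j") (auto simp: T_def)
    then show "f k \<in> T" "g k \<in> T" using max[OF fV(1)[of k]] max[OF fV(2)[of k]] fV that by (auto simp: T_def)
  qed
  have "j \<notin> T"
  proof
    assume "j \<in> T"
    then have "u (f j) + u (g j) = 2 * m + 1" using u[of j] ij by (auto simp: T_def)
    then show False using max[OF fV(1)[of j]] max[OF fV(2)[of j]] ij by auto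
  qed
  have "i \<in> T"
  proof (rule ccontr)
    assume "i \<notin> T"
    then have "f ` T \<subseteq> T" "g ` T \<subseteq> T" using stay by auto
    then have "T = V" using \<open>T \<noteq> {}\<close> by (intro connected) (auto simp: T_def)
    then show False using \<open>i \<notin> T\<close> ij by simp
  qed
  have "u (f i) + u (g i) = 2 * m - 1" using u[of i] ij \<open>i \<in> T\<close> by (auto simp: T_def)
  then have one: "(f i \<in> T) \<noteq> (g i \<in> T)"
    using max[OF fV(1)[of i]] max[OF fV(2)[of i]] fV[of i] ij by (auto simp: T_def)
  have "T \<subseteq> V" by (auto simp: T_def)
  moreover have "{k \<in> T. f k \<notin> T} = (if f i \<in> T then {} else {i})"
    "{k \<in> T. g k \<notin> T} = (if g i \<in> T then {} else {i})"
    using stay \<open>i \<in> T\<close> by auto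
  then have "outdeg T = 1" using one \<open>T \<subseteq> V\<close> by (auto simp: outdeg_def exits_eq_card)
  ultimately show ?thesis using that \<open>i \<in> T\<close> \<open>j \<notin> T\<close> by blast
qed

text \<open>In the application \<open>x k\<close> is the color of the arc passing over crossing
  \<open>k\<close>. The over arcs of \<open>f' k\<close> and \<open>g' k\<close> are those that
  start and stop at \<open>k\<close>, hence its two under arcs.\<close>

definition is_coloring :: "int \<Rightarrow> ('a \<Rightarrow> int) \<Rightarrow> bool" where
  "is_coloring p x \<longleftrightarrow> (\<forall>k\<in>V. p dvd 2 * x k - x (f' k) - x (g' k))"

text \<open>The exit of a set may lie along \<open>f\<close> or \<open>g\<close>; exchanging the two
  permutations reduces the second case to the first.\<close>

lemma permutation_digraph_commute: "permutation_digraph V g f"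
  using finite_V f g connected by unfold_locales auto

lemma is_coloring_commute: "permutation_digraph.is_coloring V g f p x = is_coloring p x"
  by (simp add: permutation_digraph.is_coloring_def[OF permutation_digraph_commute] is_coloring_def algebra_simps)

text \<open>Summing the coloring conditions over \<open>T\<close> shows that the two arcs crossing the boundary of
  \<open>T\<close> have the same color, so that \<open>x\<close> may be replaced by a constant outside \<open>T\<close>.\<close>

lemma recolor_outside_f:
  assumes T: "T \<subseteq> V" "exits f T = 1" "exits g T = 0" and x: "is_coloring p x"
  obtains i where "i \<in> T" "is_coloring p (\<lambda>k. if k \<in> T then x k else x i)"
proof -
  have card1: "card {k \<in> T. f k \<notin> T} = 1" using T by (simp add: exits_eq_card)
  then obtain i where i: "{k \<in> T. f k \<notin> T} = {i}" by (auto simp: card_1_singleton_iff)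
  have i_iff: "k \<in> T \<and> f k \<notin> T \<longleftrightarrow> k = i" for k using i by (simp add: set_eq_iff)
  \<comment> \<open>The complement has equally many exits, so a single \<open>f\<close>-edge,
    starting at \<open>l\<close>, leads back into \<open>T\<close>.\<close>
  have "exits f (V - T) = 1" using exits_Compl[OF f] T by simp
  then have "card {k \<in> V - T. f k \<notin> V - T} = 1" by (simp add: exits_eq_card)
  then obtain l where l: "{k \<in> V - T. f k \<notin> V - T} = {l}" by (auto simp: card_1_singleton_iff)
  have fV: "f k \<in> V \<longleftrightarrow> k \<in> V" for k using f by (simp add: permutes_in_image)
  have l_iff: "k \<notin> T \<and> f k \<in> T \<longleftrightarrow> k = l" for k
    using l T(1) fV[of k] by (auto simp: set_eq_iff)
  have finT: "finite T" using T finite_V finite_subset by blast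
  have "card {k \<in> T. g k \<notin> T} = 0" using T by (simp add: exits_eq_card)
  then have gT: "g ` T \<subseteq> T" using finT by auto
  have injg: "inj g" and injf: "inj f" using f g permutes_inj by auto
  \<comment> \<open>An injective self-map of a finite set is onto, so no \<open>g\<close>-edge
    enters \<open>T\<close> either.\<close>
  have gT': "g ` T = T"
    by (rule endo_inj_surj[OF finT gT inj_on_subset[OF injg subset_UNIV]])
  have ginv: "g' k \<in> T \<longleftrightarrow> k \<in> T" for k
  proof
    assume "g' k \<in> T"
    then have "g (g' k) \<in> T" using gT by blast
    then show "k \<in> T" using permutes_inverses[OF g] by simp
  next
    assume "k \<in> T"
    then obtain t where "t \<in> T" "k = g t" using gT' by blast
    then show "g' k \<in> T" using permutes_inverses[OF g] by simp
  qed
  have finv: "f' k \<in> T \<longleftrightarrow> (k \<in> T \<and> f' k \<noteq> l) \<or> f' k = i" for k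
  proof -
    have "f (f' k) = k" using permutes_inverses[OF f] by simp
    then show ?thesis using i_iff[of "f' k"] l_iff[of "f' k"] by auto
  qed
  have il: "i \<in> T" "f i \<notin> T" "l \<notin> T" "f l \<in> T" "l \<in> V"
    using i_iff[of i] l_iff[of l] fV[of l] T(1) by auto
  have invf: "f' (f k) = k" for k using permutes_inverses[OF f] by simp
  have "(\<Sum>k\<in>T. x (g' k)) = (\<Sum>k\<in>T. x k)"
    by (rule sum.reindex_bij_witness[of _ g g']) (use gT ginv permutes_inverses[OF g] in auto)
  \<comment> \<open>The image of \<open>T\<close> under \<open>f'\<close> is \<open>T\<close> with
    \<open>i\<close> replaced by \<open>l\<close>. Everything else cancels in the sum over
    \<open>T\<close>, leaving \<open>x i - x l\<close>.\<close>
  moreover have "(\<Sum>k\<in>T. x (f' k)) = (\<Sum>k\<in>insert l (T - {i}). x k)"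
  proof (rule sum.reindex_bij_witness[of _ f f'])
    fix k assume k: "k \<in> insert l (T - {i})"
    then show "f k \<in> T" using finv[of "f k"] il invf by auto
  next
    fix k assume "k \<in> T"
    moreover have "f' k \<noteq> i" using il permutes_inverses[OF f] \<open>k \<in> T\<close> by metis
    ultimately show "f' k \<in> insert l (T - {i})" using finv[of k] by auto
  qed (use permutes_inverses[OF f] in auto)
  moreover have "\<dots> = (\<Sum>k\<in>T. x k) + x l - x i"
    using finT il by (simp add: sum_diff1)
  moreover have "p dvd (\<Sum>k\<in>T. 2 * x k - x (f' k) - x (g' k))"
    using x T by (intro dvd_sum) (auto simp: is_coloring_def)
  moreover have "(\<Sum>k\<in>T. 2 * x k - x (f' k) - x (g' k)) =
      2 * (\<Sum>k\<in>T. x k) - (\<Sum>k\<in>T. x (f' k)) - (\<Sum>k\<in>T. x (g' k))"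
    by (simp add: sum_subtractf sum_distrib_left)
  ultimately have "p dvd x i - x l" by (simp del: sum.insert)
  then have li: "p dvd x l - x i" by (simp add: dvd_diff_commute)
  show ?thesis
  proof (rule that[OF il(1)], unfold is_coloring_def, intro ballI)
    fix k assume k: "k \<in> V"
    let ?y = "\<lambda>k. if k \<in> T then x k else x i"
    have *: "p dvd 2 * x k - x (f' k) - x (g' k)" using x k by (simp add: is_coloring_def)
    \<comment> \<open>Inside \<open>T\<close> the recoloring alters the condition only at
      \<open>k = f l\<close>, where \<open>x l\<close> becomes \<open>x i\<close>; outside
      \<open>T\<close> all terms are equal.\<close>
    consider "k \<in> T" "f' k = l" | "k \<in> T" "f' k \<noteq> l" | "k \<notin> T" "f' k = i"
      | "k \<notin> T" "f' k \<noteq> i" by blast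
    then show "p dvd 2 * ?y k - ?y (f' k) - ?y (g' k)"
    proof cases
      case 1
      then have "2 * ?y k - ?y (f' k) - ?y (g' k) = 2 * x k - x (f' k) - x (g' k) + (x l - x i)"
        using il ginv[of k] by simp
      then show ?thesis using dvd_add[OF * li] by (simp only:)
    qed (use * finv[of k] ginv[of k] in auto)
  qed
qed

lemma recolor_outside:
  assumes T: "T \<subseteq> V" "outdeg T = 1" and x: "is_coloring p x"
  obtains i where "i \<in> T" "is_coloring p (\<lambda>k. if k \<in> T then x k else x i)"
proof -
  consider "exits f T = 1" "exits g T = 0" | "exits f T = 0" "exits g T = 1"
    using T(2) unfolding outdeg_def by linarith
  then show ?thesis
  proof cases
    case 1
    then show ?thesis using recolor_outside_f T x that by blast
  next
    case 2
    interpret sw: permutation_digraph V g f by (rule permutation_digraph_commute)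
    obtain i where "i \<in> T" "sw.is_coloring p (\<lambda>k. if k \<in> T then x k else x i)"
      using sw.recolor_outside_f[OF T(1), of p x] 2 x
      by (auto simp: is_coloring_commute sw.exits_def exits_def)
    then show ?thesis using that by (simp add: is_coloring_commute)
  qed
qed

text \<open>The recoloring is an affine image \<open>a * x + b\<close> of \<open>x\<close>. If
  \<open>x\<close> differs from the constant \<open>x i\<close> somewhere outside \<open>T\<close>,
  where the recoloring is constant, then \<open>p\<close> divides \<open>a\<close>; the recoloring,
  and with it \<open>x\<close>, is then constant on \<open>T\<close>.\<close>

lemma constant_side:
  assumes T: "T \<subseteq> V" "outdeg T = 1" and x: "is_coloring p x" and "prime p"
    and unique: "\<And>y. is_coloring p y \<Longrightarrow> \<exists>a b. \<forall>k\<in>V. p dvd y k - (a * x k + b)"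
  obtains S where "S = T \<or> S = V - T" "\<And>k l. k \<in> S \<Longrightarrow> l \<in> S \<Longrightarrow> p dvd x k - x l"
proof -
  obtain i where i: "i \<in> T" "is_coloring p (\<lambda>k. if k \<in> T then x k else x i)"
    using recolor_outside[OF T x] .
  then obtain a b where ab: "\<And>k. k \<in> V \<Longrightarrow> p dvd (if k \<in> T then x k else x i) - (a * x k + b)"
    using unique by blast
  have eqI: "p dvd x k - x l" if "p dvd x k - x i" "p dvd x l - x i" for k l
    using dvd_diff[OF that] by simp
  show ?thesis
  proof (cases "\<forall>k\<in>V - T. p dvd x k - x i")
    case True
    then show ?thesis using that[of "V - T"] eqI by blast
  next
    case False
    then obtain t where t: "t \<in> V" "t \<notin> T" "\<not> p dvd x t - x i" by auto
    have "p dvd a * (x t - x i)"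
      using dvd_diff[OF ab[of i] ab[of t]] t i T by (auto simp: algebra_simps)
    then have "p dvd a" using t \<open>prime p\<close> by (simp add: prime_dvd_mult_iff)
    have "p dvd x k - x i" if "k \<in> T" for k
    proof -
      have "p dvd (x k - (a * x k + b)) - (x i - (a * x i + b))"
        using dvd_diff[OF ab[of k] ab[of i]] that i T by auto
      moreover have "p dvd a * (x k - x i)" using \<open>p dvd a\<close> by simp
      ultimately have "p dvd (x k - (a * x k + b)) - (x i - (a * x i + b)) + a * (x k - x i)"
        by (rule dvd_add)
      then show ?thesis by (simp add: algebra_simps)
    qed
    then show ?thesis using that[of T] eqI by blast
  qed
qed

text \<open>A smallest set with a single exit on which \<open>x\<close> is constant must be a singleton, since
  otherwise the level set separating two of its elements could be used to cut it down.\<close>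

lemma fixed_point_of_equal_colors:
  assumes x: "is_coloring p x" and "prime p"
    and unique: "\<And>y. is_coloring p y \<Longrightarrow> \<exists>a b. \<forall>k\<in>V. p dvd y k - (a * x k + b)"
    and potential: "\<And>i j. i \<in> V \<Longrightarrow> j \<in> V \<Longrightarrow> p dvd x i - x j \<Longrightarrow>
      \<exists>u::'a \<Rightarrow> int. \<forall>k\<in>V. 2 * u k - u (f k) - u (g k) = of_bool (k = i) - of_bool (k = j)"
    and ij: "i \<in> V" "j \<in> V" "i \<noteq> j" "p dvd x i - x j"
  obtains k where "k \<in> V" "f k = k \<or> g k = k"
proof -
  have cut: "\<exists>T. T \<subseteq> V \<and> i \<in> T \<and> j \<notin> T \<and> outdeg T = 1"
    if "i \<in> V" "j \<in> V" "i \<noteq> j" "p dvd x i - x j" for i j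
    using level_set_of_potential[of i j] potential[of i j] that by metis
  define good where "good S \<longleftrightarrow> S \<subseteq> V \<and> S \<noteq> {} \<and> S \<noteq> V \<and> outdeg S = 1 \<and>
    (\<forall>k\<in>S. \<forall>l\<in>S. p dvd x k - x l)" for S
  obtain T where T: "T \<subseteq> V" "i \<in> T" "j \<notin> T" "outdeg T = 1" using cut[OF ij] by blast
  obtain S0 where "S0 = T \<or> S0 = V - T" "\<And>k l. k \<in> S0 \<Longrightarrow> l \<in> S0 \<Longrightarrow> p dvd x k - x l"
    using constant_side[OF T(1,4) x \<open>prime p\<close> unique] by blast
  then have "good S0" using T ij outdeg_Compl[of T] by (auto simp: good_def)
  then obtain S where S: "good S" and minimal: "\<And>S'. good S' \<Longrightarrow> card S \<le> card S'"
    using arg_min_natI[of good _ card] arg_min_nat_le[of good _ card] by metis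
  have finS: "finite S" using S finite_V finite_subset by (auto simp: good_def)
  obtain k where k: "k \<in> S" using S by (auto simp: good_def)
  have "S \<subseteq> {k}"
  proof (rule ccontr)
    assume "\<not> S \<subseteq> {k}"
    then obtain l where l: "l \<in> S" "l \<noteq> k" by blast
    then obtain T where T: "T \<subseteq> V" "k \<in> T" "l \<notin> T" "outdeg T = 1"
      using cut[of k l] k l S unfolding good_def by blast
    \<comment> \<open>Uncrossing requires that \<open>S \<union> R\<close> is not all of
      \<open>V\<close>; if \<open>T\<close> fails this, its complement, which also splits
      \<open>S\<close>, is taken instead.\<close>
    have "\<exists>R. R \<subseteq> V \<and> outdeg R = 1 \<and> S \<inter> R \<noteq> {} \<and> \<not> S \<subseteq> R \<and> S \<union> R \<noteq> V"
    proof (cases "S \<union> T = V")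
      case True
      have "S \<union> (V - T) \<noteq> V" using True S T by (auto simp: good_def)
      then show ?thesis using T k l S outdeg_Compl[of T] by (intro exI[of _ "V - T"]) (auto simp: good_def)
    next
      case False
      then show ?thesis using T k l by (intro exI[of _ T]) auto
    qed
    then obtain R where R: "R \<subseteq> V" "outdeg R = 1" "S \<inter> R \<noteq> {}" "\<not> S \<subseteq> R" "S \<union> R \<noteq> V" by blast
    have "outdeg (S \<inter> R) = 1" using uncross[of S R] R S by (auto simp: good_def)
    then have "good (S \<inter> R)" using S R by (auto simp: good_def)
    moreover have "card (S \<inter> R) < card S" using R finS by (intro psubset_card_mono) auto
    ultimately show False using minimal by fastforce
  qed
  then have Sk: "S = {k}" using k by blast
  have "k \<in> V" "outdeg {k} = 1" using S Sk by (auto simp: good_def)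
  \<comment> \<open>With a single exit from \<open>{k}\<close>, one of the two edges at
    \<open>k\<close> has to lead back to \<open>k\<close>.\<close>
  then have *: "card {x \<in> {k}. f x \<notin> {k}} + card {x \<in> {k}. g x \<notin> {k}} = 1"
    by (simp add: outdeg_def exits_eq_card)
  have "f k = k \<or> g k = k"
  proof (rule ccontr)
    assume "\<not> (f k = k \<or> g k = k)"
    then have "{x \<in> {k}. f x \<notin> {k}} = {k}" "{x \<in> {k}. g x \<notin> {k}} = {k}" by auto
    then show False using * by simp
  qed
  then show ?thesis using that \<open>k \<in> V\<close> by blast
qed

end

section \<open>Kinks are nugatory\<close>

text \<open>Coordinates with respect to the basis \<open>v\<close>, \<open>w\<close>, given by
  Cramer's rule with determinant \<open>d\<close>.\<close>

lemma plane_coordinates: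
  fixes v w :: complex
  assumes "\<not> collinear {0, v, w}"
  obtains \<alpha> \<beta> :: "complex \<Rightarrow> real"
  where "bounded_linear \<alpha>" "bounded_linear \<beta>" "\<alpha> v = 1" "\<beta> v = 0" "\<alpha> w = 0" "\<beta> w = 1"
proof -
  define d where "d = Re v * Im w - Im v * Re w"
  have "d \<noteq> 0"
  proof
    assume "d = 0"
    then have eq: "Re v * Im w = Im v * Re w" by (simp add: d_def)
    have "v \<noteq> 0" using assms by auto
    then have nz: "(Re v)\<^sup>2 + (Im v)\<^sup>2 \<noteq> 0" by (simp add: complex_eq_iff sum_power2_eq_zero_iff)
    \<comment> \<open>\<open>?c *\<^sub>R v\<close> is the orthogonal projection of \<open>w\<close>
      to the line through \<open>v\<close>; for \<open>d = 0\<close> it is \<open>w\<close>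
      itself.\<close>
    let ?c = "(Re v * Re w + Im v * Im w) / ((Re v)\<^sup>2 + (Im v)\<^sup>2)"
    have "((Re v)\<^sup>2 + (Im v)\<^sup>2) * Re w - (Re v * Re w + Im v * Im w) * Re v =
        Im v * (Im v * Re w - Re v * Im w)"
      by (simp add: algebra_simps power2_eq_square)
    then have Re: "((Re v)\<^sup>2 + (Im v)\<^sup>2) * Re w = (Re v * Re w + Im v * Im w) * Re v"
      using eq by simp
    have "((Re v)\<^sup>2 + (Im v)\<^sup>2) * Im w - (Re v * Re w + Im v * Im w) * Im v =
        Re v * (Re v * Im w - Im v * Re w)"
      by (simp add: algebra_simps power2_eq_square)
    then have Im: "((Re v)\<^sup>2 + (Im v)\<^sup>2) * Im w = (Re v * Re w + Im v * Im w) * Im v"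
      using eq by simp
    have "w = ?c *\<^sub>R v"
      using nz Re Im by (simp add: complex_eq_iff field_simps)
    then show False using assms collinear_lemma by blast
  qed
  let ?a = "\<lambda>\<zeta>. (Re \<zeta> * Im w - Im \<zeta> * Re w) / d"
  let ?b = "\<lambda>\<zeta>. (Re v * Im \<zeta> - Im v * Re \<zeta>) / d"
  have "bounded_linear ?a"
    unfolding linear_conv_bounded_linear[symmetric]
    by (rule linearI) (auto simp: algebra_simps add_divide_distrib diff_divide_distrib)
  moreover have "bounded_linear ?b"
    unfolding linear_conv_bounded_linear[symmetric]
    by (rule linearI) (auto simp: algebra_simps add_divide_distrib diff_divide_distrib)
  ultimately show ?thesis
    using that[of ?a ?b] \<open>d \<noteq> 0\<close> by (simp add: d_def)
qed

text \<open>The difference quotients of the coordinates \<open>\<alpha>\<close> and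
  \<open>\<beta>\<close> tend to 1 and 0, so near \<open>s\<close> the threshold 1/2 separates them;
  clearing the denominator \<open>r - s\<close> gives the cones on both sides.\<close>

lemma tangent_cone:
  fixes \<gamma> :: "real \<Rightarrow> complex" and \<alpha> \<beta> :: "complex \<Rightarrow> real"
  assumes "(\<gamma> has_vector_derivative v) (at s)" "bounded_linear \<alpha>" "bounded_linear \<beta>"
    and "\<alpha> v = 1" "\<beta> v = 0"
  obtains \<delta> where "\<delta> > 0"
    "\<And>r. \<bar>r - s\<bar> < \<delta> \<Longrightarrow> s < r \<Longrightarrow> \<bar>\<beta> (\<gamma> r - \<gamma> s)\<bar> < \<alpha> (\<gamma> r - \<gamma> s)"
    "\<And>r. \<bar>r - s\<bar> < \<delta> \<Longrightarrow> r < s \<Longrightarrow> \<bar>\<beta> (\<gamma> r - \<gamma> s)\<bar> < - \<alpha> (\<gamma> r - \<gamma> s)"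
proof -
  interpret \<alpha>: bounded_linear \<alpha> by fact
  interpret \<beta>: bounded_linear \<beta> by fact
  have "((\<lambda>r. \<alpha> (\<gamma> r)) has_vector_derivative 1) (at s)"
    using \<alpha>.has_vector_derivative[OF assms(1)] assms(4) by simp
  then have a: "((\<lambda>r. (\<alpha> (\<gamma> r) - \<alpha> (\<gamma> s)) / (r - s)) \<longlongrightarrow> 1) (at s)"
    by (simp add: has_real_derivative_iff_has_vector_derivative[symmetric] has_field_derivative_iff)
  have "((\<lambda>r. \<beta> (\<gamma> r)) has_vector_derivative 0) (at s)"
    using \<beta>.has_vector_derivative[OF assms(1)] assms(5) by simp
  then have b: "((\<lambda>r. (\<beta> (\<gamma> r) - \<beta> (\<gamma> s)) / (r - s)) \<longlongrightarrow> 0) (at s)"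
    by (simp add: has_real_derivative_iff_has_vector_derivative[symmetric] has_field_derivative_iff)
  have "eventually (\<lambda>r. (\<alpha> (\<gamma> r) - \<alpha> (\<gamma> s)) / (r - s) > 1/2 \<and>
          \<bar>(\<beta> (\<gamma> r) - \<beta> (\<gamma> s)) / (r - s)\<bar> < 1/2) (at s)"
    using order_tendstoD(1)[OF a, of "1/2"] order_tendstoD[OF tendsto_rabs[OF b], of "1/2"]
    by (auto intro: eventually_conj)
  then obtain \<delta> where "\<delta> > 0" and
    \<delta>: "\<And>r. r \<noteq> s \<Longrightarrow> \<bar>r - s\<bar> < \<delta> \<Longrightarrow> (\<alpha> (\<gamma> r) - \<alpha> (\<gamma> s)) / (r - s) > 1/2 \<and>
          \<bar>(\<beta> (\<gamma> r) - \<beta> (\<gamma> s)) / (r - s)\<bar> < 1/2"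
    by (auto simp: eventually_at dist_real_def)
  show ?thesis
  proof (rule that[OF \<open>\<delta> > 0\<close>])
    fix r assume "\<bar>r - s\<bar> < \<delta>" "s < r"
    with \<delta>[of r] have "(r - s) / 2 < \<alpha> (\<gamma> r) - \<alpha> (\<gamma> s)" "\<bar>\<beta> (\<gamma> r) - \<beta> (\<gamma> s)\<bar> < (r - s) / 2"
      by (auto simp: field_simps abs_divide)
    then show "\<bar>\<beta> (\<gamma> r - \<gamma> s)\<bar> < \<alpha> (\<gamma> r - \<gamma> s)" by (simp add: \<alpha>.diff \<beta>.diff)
  next
    fix r assume "\<bar>r - s\<bar> < \<delta>" "r < s"
    with \<delta>[of r] have "(s - r) / 2 < \<alpha> (\<gamma> s) - \<alpha> (\<gamma> r)" "\<bar>\<beta> (\<gamma> r) - \<beta> (\<gamma> s)\<bar> < (s - r) / 2"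
      by (auto simp: field_simps abs_divide)
    then show "\<bar>\<beta> (\<gamma> r - \<gamma> s)\<bar> < - \<alpha> (\<gamma> r - \<gamma> s)" by (simp add: \<alpha>.diff \<beta>.diff)
  qed
qed

text \<open>Near \<open>z\<close> the loop stays in thin cones around \<open>v\<close> and \<open>- w\<close>, so that one can walk around \<open>z\<close> from
  \<open>v + w\<close> through \<open>w - v\<close> to \<open>- v - w\<close>.\<close>

lemma loop_misses_opposite_sectors:
  fixes \<gamma> :: "real \<Rightarrow> complex"
  assumes "s < t" and cont: "continuous_on {s..t} \<gamma>"
    and z: "\<gamma> s = z" "\<gamma> t = z" "\<And>r. s < r \<Longrightarrow> r < t \<Longrightarrow> \<gamma> r \<noteq> z"
    and v: "(\<gamma> has_vector_derivative v) (at s)" and w: "(\<gamma> has_vector_derivative w) (at t)"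
    and indep: "\<not> collinear {0, v, w}"
  obtains \<eta> where "\<eta> > 0"
    "\<And>\<epsilon>. 0 < \<epsilon> \<Longrightarrow> \<epsilon> < \<eta> \<Longrightarrow>
       connected_component (- \<gamma> ` {s..t}) (z + \<epsilon> *\<^sub>R (v + w)) (z - \<epsilon> *\<^sub>R (v + w))"
proof -
  obtain \<alpha> \<beta> :: "complex \<Rightarrow> real" where lin: "bounded_linear \<alpha>" "bounded_linear \<beta>"
    and co: "\<alpha> v = 1" "\<beta> v = 0" "\<alpha> w = 0" "\<beta> w = 1"
    using plane_coordinates[OF indep] .
  interpret \<alpha>: bounded_linear \<alpha> by fact
  interpret \<beta>: bounded_linear \<beta> by fact
  obtain \<delta>1 where "\<delta>1 > 0" and \<delta>1: "\<And>r. \<bar>r - s\<bar> < \<delta>1 \<Longrightarrow> s < r \<Longrightarrow> \<bar>\<beta> (\<gamma> r - z)\<bar> < \<alpha> (\<gamma> r - z)"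
    using tangent_cone[OF v lin co(1,2)] z by metis
  obtain \<delta>2 where "\<delta>2 > 0" and \<delta>2: "\<And>r. \<bar>r - t\<bar> < \<delta>2 \<Longrightarrow> r < t \<Longrightarrow> \<bar>\<alpha> (\<gamma> r - z)\<bar> < - \<beta> (\<gamma> r - z)"
    using tangent_cone[OF w lin(2,1) co(4,3)] z by metis
  \<comment> \<open>The part of the loop away from its ends is compact and misses \<open>z\<close>,
    hence keeps a distance \<open>\<rho>\<close> from \<open>z\<close>.\<close>
  let ?M = "\<gamma> ` {s + \<delta>1..t - \<delta>2}"
  have "compact ?M"
    using \<open>\<delta>1 > 0\<close> \<open>\<delta>2 > 0\<close> by (intro compact_continuous_image continuous_on_subset[OF cont]) auto
  moreover have "z \<notin> ?M" using z(3) \<open>\<delta>1 > 0\<close> \<open>\<delta>2 > 0\<close> by force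
  ultimately obtain \<rho> where "\<rho> > 0" and \<rho>: "\<And>x. x \<in> ?M \<Longrightarrow> \<rho> \<le> dist z x"
    using separate_point_closed[OF compact_imp_closed] by metis
  have sector: "\<zeta> = z \<or> norm (\<zeta> - z) \<ge> \<rho> \<or> \<bar>\<beta> (\<zeta> - z)\<bar> < \<alpha> (\<zeta> - z) \<or> \<bar>\<alpha> (\<zeta> - z)\<bar> < - \<beta> (\<zeta> - z)"
    if \<zeta>: "\<zeta> \<in> \<gamma> ` {s..t}" for \<zeta>
  proof -
    obtain r where r: "s \<le> r" "r \<le> t" "\<zeta> = \<gamma> r" using \<zeta> by auto
    consider "r = s \<or> r = t" | "s < r" "r < t" "r < s + \<delta>1" | "s < r" "r < t" "r > t - \<delta>2"
      | "s + \<delta>1 \<le> r" "r \<le> t - \<delta>2" using r by linarith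
    then show ?thesis
    proof cases
      case 1 then show ?thesis using r z by auto
    next
      case 2 then show ?thesis using \<delta>1[of r] r by auto
    next
      case 3 then show ?thesis using \<delta>2[of r] r by auto
    next
      case 4 then have "\<zeta> \<in> ?M" using r by auto
      then show ?thesis using \<rho>[of \<zeta>] by (simp add: dist_norm norm_minus_commute)
    qed
  qed
  \<comment> \<open>For \<open>\<epsilon> < \<eta>\<close> the walk below stays within distance
    \<open>\<rho>\<close> of \<open>z\<close>; adding 1 keeps the denominator positive.\<close>
  define \<eta> where "\<eta> = \<rho> / (norm v + norm w + 1)"
  have pos: "norm v + norm w + 1 > 0" by (smt (verit) norm_ge_zero)
  show ?thesis
  proof (rule that)
    show "\<eta> > 0" using \<open>\<rho> > 0\<close> pos by (simp add: \<eta>_def)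
    fix \<epsilon> :: real assume \<epsilon>: "0 < \<epsilon>" "\<epsilon> < \<eta>"
    \<comment> \<open>In coordinates the walk follows the sides \<open>y = \<epsilon>\<close> and
      \<open>x = - \<epsilon>\<close> of a square, which avoid the cones
      \<open>\<bar>y\<bar> < x\<close> around \<open>v\<close> and
      \<open>\<bar>x\<bar> < - y\<close> around \<open>- w\<close>.\<close>
    have out: "z + (x *\<^sub>R v + y *\<^sub>R w) \<notin> \<gamma> ` {s..t}"
      if xy: "\<bar>x\<bar> \<le> \<epsilon>" "\<bar>y\<bar> \<le> \<epsilon>" "y = \<epsilon> \<or> x = -\<epsilon>" for x y
    proof
      let ?\<zeta> = "x *\<^sub>R v + y *\<^sub>R w"
      assume "z + ?\<zeta> \<in> \<gamma> ` {s..t}"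
      from sector[OF this]
      have *: "?\<zeta> = 0 \<or> norm ?\<zeta> \<ge> \<rho> \<or> \<bar>\<beta> ?\<zeta>\<bar> < \<alpha> ?\<zeta> \<or> \<bar>\<alpha> ?\<zeta>\<bar> < - \<beta> ?\<zeta>" by simp
      have A: "\<alpha> ?\<zeta> = x" "\<beta> ?\<zeta> = y"
        by (simp_all add: \<alpha>.add \<alpha>.scaleR \<beta>.add \<beta>.scaleR co)
      have "norm ?\<zeta> \<le> \<bar>x\<bar> * norm v + \<bar>y\<bar> * norm w"
        by (rule order_trans[OF norm_triangle_ineq]) simp
      also have "\<dots> \<le> \<epsilon> * norm v + \<epsilon> * norm w"
        using xy by (intro add_mono mult_right_mono) auto
      also have "\<dots> < \<epsilon> * (norm v + norm w + 1)" using \<epsilon> by (simp add: algebra_simps)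
      also have "\<dots> < \<rho>" using \<epsilon>(2) pos by (simp add: \<eta>_def field_simps)
      finally have "norm ?\<zeta> < \<rho>" .
      moreover have "?\<zeta> \<noteq> 0" using A xy \<epsilon> \<alpha>.zero \<beta>.zero by force
      ultimately show False using * A xy \<epsilon> by linarith
    qed
    let ?a = "z + (\<epsilon> *\<^sub>R v + \<epsilon> *\<^sub>R w)" and ?c = "z + ((-\<epsilon>) *\<^sub>R v + \<epsilon> *\<^sub>R w)"
      and ?b = "z + ((-\<epsilon>) *\<^sub>R v + (-\<epsilon>) *\<^sub>R w)"
    have bound: "\<bar>(1 - u) * \<epsilon> - u * \<epsilon>\<bar> \<le> \<epsilon>" if "0 \<le> u" "u \<le> 1" for u
    proof -
      have "(1 - u) * \<epsilon> - u * \<epsilon> = \<epsilon> - 2 * (u * \<epsilon>)" by (simp add: algebra_simps)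
      moreover have "0 \<le> u * \<epsilon>" "u * \<epsilon> \<le> \<epsilon>" using that \<epsilon> by (auto simp: mult_left_le_one_le)
      ultimately show ?thesis by linarith
    qed
    have "closed_segment ?a ?c \<subseteq> - \<gamma> ` {s..t}"
    proof
      fix \<zeta> assume "\<zeta> \<in> closed_segment ?a ?c"
      then obtain u where u: "0 \<le> u" "u \<le> 1" "\<zeta> = (1 - u) *\<^sub>R ?a + u *\<^sub>R ?c"
        by (auto simp: in_segment)
      then have "\<zeta> = z + (((1 - u) * \<epsilon> - u * \<epsilon>) *\<^sub>R v + \<epsilon> *\<^sub>R w)"
        by (simp add: complex_eq_iff algebra_simps)
      then show "\<zeta> \<in> - \<gamma> ` {s..t}" using out[of "(1 - u) * \<epsilon> - u * \<epsilon>" \<epsilon>] bound[OF u(1,2)] \<epsilon> by auto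
    qed
    moreover have "closed_segment ?c ?b \<subseteq> - \<gamma> ` {s..t}"
    proof
      fix \<zeta> assume "\<zeta> \<in> closed_segment ?c ?b"
      then obtain u where u: "0 \<le> u" "u \<le> 1" "\<zeta> = (1 - u) *\<^sub>R ?c + u *\<^sub>R ?b"
        by (auto simp: in_segment)
      then have "\<zeta> = z + ((-\<epsilon>) *\<^sub>R v + ((1 - u) * \<epsilon> - u * \<epsilon>) *\<^sub>R w)"
        by (simp add: complex_eq_iff algebra_simps)
      then show "\<zeta> \<in> - \<gamma> ` {s..t}" using out[of "-\<epsilon>" "(1 - u) * \<epsilon> - u * \<epsilon>"] bound[OF u(1,2)] \<epsilon> by auto
    qed
    ultimately have "connected_component (- \<gamma> ` {s..t}) ?a ?c" "connected_component (- \<gamma> ` {s..t}) ?c ?b"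
      by (meson connected_component_def connected_segment ends_in_segment)+
    then have "connected_component (- \<gamma> ` {s..t}) ?a ?b"
      by (rule connected_component_trans)
    moreover have "?a = z + \<epsilon> *\<^sub>R (v + w)" "?b = z - \<epsilon> *\<^sub>R (v + w)"
      by (simp_all add: algebra_simps)
    ultimately show "connected_component (- \<gamma> ` {s..t}) (z + \<epsilon> *\<^sub>R (v + w)) (z - \<epsilon> *\<^sub>R (v + w))"
      by metis
  qed
qed

text \<open>An arc outside \<open>S\<close> joins the two sides of the gap. Cut to a stretch between
  the two halves of the gap, it is closed up by a straight segment through \<open>z\<close>.\<close>

lemma closed_loop_through_gap:
  fixes S :: "complex set"
  assumes "closed S" "z \<in> S" "d \<noteq> 0" "\<epsilon> > 0"
    and gap: "\<And>\<tau>. \<tau> \<noteq> 0 \<Longrightarrow> \<bar>\<tau>\<bar> \<le> \<epsilon> \<Longrightarrow> z + \<tau> *\<^sub>R d \<notin> S"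
    and conn: "connected_component (- S) (z + \<epsilon> *\<^sub>R d) (z - \<epsilon> *\<^sub>R d)"
  obtains J r \<kappa> where "simple_path J" "pathfinish J = pathstart J" "path_image J \<inter> S = {z}"
    "0 < r" "r < 1" "J r = z" "\<kappa> \<noteq> 0" "(J has_vector_derivative \<kappa> *\<^sub>R d) (at r)"
proof -
  let ?a = "z + \<epsilon> *\<^sub>R d" and ?b = "z - \<epsilon> *\<^sub>R d"
  have "?a \<noteq> ?b"
  proof
    assume "?a = ?b"
    then have "(2 * \<epsilon>) *\<^sub>R d = 0" by (simp add: algebra_simps flip: scaleR_left_distrib)
    then show False using \<open>d \<noteq> 0\<close> \<open>\<epsilon> > 0\<close> by simp
  qed
  have "path_component (- S) ?a ?b"
    using conn \<open>closed S\<close> by (simp add: open_path_connected_component open_Compl)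
  then obtain q where q: "path q" "path_image q \<subseteq> - S" "pathstart q = ?a" "pathfinish q = ?b"
    by (auto simp: path_component_def)
  obtain g where g: "arc g" "path_image g \<subseteq> - S" "g 0 = ?a" "g 1 = ?b"
    using path_contains_arc[OF q(1,3,4) \<open>?a \<noteq> ?b\<close>] q(2)
    by (metis (no_types) order_trans pathstart_def pathfinish_def)
  have gc: "continuous_on {0..1} g" and gi: "inj_on g {0..1}"
    using g(1) by (auto simp: arc_def path_def)
  have gS: "g x \<notin> S" if "0 \<le> x" "x \<le> 1" for x
    using g(2) that by (auto simp: path_image_def image_subset_iff)
  have preimage: "compact ({0..1} \<inter> g -` closed_segment x y)" for x y
    using continuous_closed_preimage[OF gc, of "closed_segment x y"]
    by (simp add: compact_eq_bounded_closed bounded_Int)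
  \<comment> \<open>The last visit of \<open>g\<close> to the segment on one side of
    \<open>z\<close>, and then the first later visit to the segment on the other side; in between
    \<open>g\<close> stays off the gap.\<close>
  obtain x0 where x0: "0 \<le> x0" "x0 \<le> 1" "g x0 \<in> closed_segment z ?a"
    and x0_max: "\<And>x. 0 \<le> x \<Longrightarrow> x \<le> 1 \<Longrightarrow> g x \<in> closed_segment z ?a \<Longrightarrow> x \<le> x0"
  proof -
    let ?A = "{0..1} \<inter> g -` closed_segment z ?a"
    have "0 \<in> ?A" using g(3) by simp
    then obtain x where "x \<in> ?A" "\<forall>y\<in>?A. y \<le> x"
      using compact_attains_sup[OF preimage, of z ?a] by blast
    then show ?thesis by (intro that[of x]) auto
  qed
  obtain x1 where x1: "x0 \<le> x1" "x1 \<le> 1" "g x1 \<in> closed_segment z ?b"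
    and x1_min: "\<And>x. x0 \<le> x \<Longrightarrow> x \<le> 1 \<Longrightarrow> g x \<in> closed_segment z ?b \<Longrightarrow> x1 \<le> x"
  proof -
    let ?B = "{x0..1} \<inter> ({0..1} \<inter> g -` closed_segment z ?b)"
    have "1 \<in> ?B" using g(4) x0 by simp
    moreover have "compact ?B" by (intro compact_Int preimage) simp
    ultimately obtain x where "x \<in> ?B" "\<forall>y\<in>?B. x \<le> y"
      using compact_attains_inf[of ?B] by blast
    then show ?thesis using x0 by (intro that[of x]) auto
  qed
  obtain \<tau>0 where \<tau>0: "0 < \<tau>0" "\<tau>0 \<le> \<epsilon>" "g x0 = z + \<tau>0 *\<^sub>R d"
  proof -
    obtain u where u: "0 \<le> u" "u \<le> 1" "g x0 = (1 - u) *\<^sub>R z + u *\<^sub>R ?a"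
      using x0(3) by (auto simp: in_segment)
    then have eq: "g x0 = z + (u * \<epsilon>) *\<^sub>R d" by (simp add: algebra_simps)
    have "u \<noteq> 0" using gS[of x0] x0 \<open>z \<in> S\<close> eq by auto
    then show ?thesis using u \<open>\<epsilon> > 0\<close> eq by (intro that[of "u * \<epsilon>"]) (auto simp: mult_left_le_one_le)
  qed
  obtain \<tau>1 where \<tau>1: "0 < \<tau>1" "\<tau>1 \<le> \<epsilon>" "g x1 = z - \<tau>1 *\<^sub>R d"
  proof -
    obtain u where u: "0 \<le> u" "u \<le> 1" "g x1 = (1 - u) *\<^sub>R z + u *\<^sub>R ?b"
      using x1(3) by (auto simp: in_segment)
    then have eq: "g x1 = z - (u * \<epsilon>) *\<^sub>R d" by (simp add: algebra_simps)
    have "u \<noteq> 0" using gS[of x1] x0 x1 \<open>z \<in> S\<close> eq by auto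
    then show ?thesis using u \<open>\<epsilon> > 0\<close> eq by (intro that[of "u * \<epsilon>"]) (auto simp: mult_left_le_one_le)
  qed
  \<comment> \<open>The closing segment passes through \<open>z\<close> at parameter
    \<open>\<rho>\<close>, which in the joined path becomes \<open>(1 + \<rho>) / 2\<close>.\<close>
  define \<rho> where "\<rho> = \<tau>1 / (\<tau>0 + \<tau>1)"
  have \<rho>: "0 < \<rho>" "\<rho> < 1" "\<rho> * (\<tau>0 + \<tau>1) = \<tau>1" using \<tau>0 \<tau>1 by (auto simp: \<rho>_def field_simps)
  have diff: "g x0 - g x1 = (\<tau>0 + \<tau>1) *\<^sub>R d" using \<tau>0(3) \<tau>1(3) by (simp add: algebra_simps)
  then have "g x0 \<noteq> g x1" using \<open>d \<noteq> 0\<close> \<tau>0 \<tau>1 by auto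
  then have "x0 \<noteq> x1" by auto
  let ?J1 = "subpath x0 x1 g" and ?J2 = "linepath (g x1) (g x0)"
  have line: "?J2 u = z + (u * (\<tau>0 + \<tau>1) - \<tau>1) *\<^sub>R d" for u
    unfolding linepath_def \<tau>0(3) \<tau>1(3) by (simp add: complex_eq_iff algebra_simps)
  have range: "- \<tau>1 \<le> u * (\<tau>0 + \<tau>1) - \<tau>1" "u * (\<tau>0 + \<tau>1) - \<tau>1 \<le> \<tau>0" if "0 \<le> u" "u \<le> 1" for u
  proof -
    have "u * (\<tau>0 + \<tau>1) \<le> \<tau>0 + \<tau>1" "0 \<le> u * (\<tau>0 + \<tau>1)"
      using that \<tau>0(1) \<tau>1(1) by (auto intro!: mult_left_le_one_le)
    then show "- \<tau>1 \<le> u * (\<tau>0 + \<tau>1) - \<tau>1" "u * (\<tau>0 + \<tau>1) - \<tau>1 \<le> \<tau>0" by linarith+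
  qed
  have on_line: "\<exists>u. 0 \<le> u \<and> u \<le> 1 \<and> \<zeta> = ?J2 u" if "\<zeta> \<in> path_image ?J2" for \<zeta>
    using that unfolding path_image_def by (metis atLeastAtMost_iff imageE)
  have meet: "path_image ?J1 \<inter> path_image ?J2 \<subseteq> {g x0, g x1}"
  proof
    fix \<zeta> assume "\<zeta> \<in> path_image ?J1 \<inter> path_image ?J2"
    then have \<zeta>: "\<zeta> \<in> path_image ?J1" "\<zeta> \<in> path_image ?J2" by blast+
    obtain x where x: "x0 \<le> x" "x \<le> x1" "\<zeta> = g x"
      using \<zeta>(1) x1(1) by (auto simp: path_image_subpath)
    obtain u where u: "0 \<le> u" "u \<le> 1" "\<zeta> = ?J2 u" using on_line[OF \<zeta>(2)] by blast
    define y where "y = u * (\<tau>0 + \<tau>1) - \<tau>1"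
    have y: "\<zeta> = z + y *\<^sub>R d" "- \<epsilon> \<le> y" "y \<le> \<epsilon>"
      using line[of u] range[OF u(1,2)] u(3) \<tau>0 \<tau>1 by (auto simp: y_def)
    show "\<zeta> \<in> {g x0, g x1}"
    proof (cases "y \<ge> 0")
      case True
      have "\<zeta> = (1 - y / \<epsilon>) *\<^sub>R z + (y / \<epsilon>) *\<^sub>R ?a"
        using y(1) \<open>\<epsilon> > 0\<close> by (simp add: algebra_simps)
      then have "\<zeta> \<in> closed_segment z ?a"
        unfolding in_segment using True y \<open>\<epsilon> > 0\<close> by (intro exI[of _ "y / \<epsilon>"]) auto
      then show ?thesis using x0_max[of x] x x0 x1 by auto
    next
      case False
      have "\<zeta> = (1 - (- y / \<epsilon>)) *\<^sub>R z + (- y / \<epsilon>) *\<^sub>R ?b"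
        using y(1) \<open>\<epsilon> > 0\<close> by (simp add: algebra_simps)
      then have "\<zeta> \<in> closed_segment z ?b"
        unfolding in_segment using False y \<open>\<epsilon> > 0\<close> by (intro exI[of _ "- y / \<epsilon>"]) (auto simp: field_simps)
      then show ?thesis using x1_min[of x] x x0 x1 by auto
    qed
  qed
  let ?J = "?J1 +++ ?J2"
  let ?r = "(1 + \<rho>) / 2"
  show ?thesis
  proof (rule that)
    show "simple_path ?J"
      by (rule simple_path_join_loop)
        (use meet \<open>x0 \<noteq> x1\<close> x0 x1 g(1) \<open>g x0 \<noteq> g x1\<close> in \<open>auto intro!: arc_subpath_arc arc_linepath\<close>)
    show "pathfinish ?J = pathstart ?J" by simp
    have "path_image ?J \<inter> S \<subseteq> {z}"
    proof
      fix \<zeta> assume "\<zeta> \<in> path_image ?J \<inter> S"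
      moreover have "path_image ?J1 \<inter> S = {}"
        using gS x0 x1 by (auto simp: path_image_subpath)
      ultimately have "\<zeta> \<in> path_image ?J2" "\<zeta> \<in> S" by (auto simp: path_image_join)
      then obtain u where u: "0 \<le> u" "u \<le> 1" "\<zeta> = ?J2 u" using on_line by blast
      define y where "y = u * (\<tau>0 + \<tau>1) - \<tau>1"
      have "\<bar>y\<bar> \<le> \<epsilon>" using range[OF u(1,2)] \<tau>0(2) \<tau>1(2) unfolding y_def by linarith
      then have "y = 0" using gap[of y] line[of u] u(3) \<open>\<zeta> \<in> S\<close> unfolding y_def by metis
      then show "\<zeta> \<in> {z}" using line[of u] u(3) unfolding y_def by simp
    qed
    show "0 < ?r" "?r < 1" using \<rho> by auto
    have "2 * ?r - 1 = \<rho>" by (simp add: field_simps)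
    then show Jr: "?J ?r = z" using \<rho> line[of \<rho>] by (simp add: joinpaths_def)
    have "z \<in> path_image ?J"
      unfolding path_image_def using \<rho> Jr by (intro image_eqI[of _ _ ?r]) auto
    then show "path_image ?J \<inter> S = {z}"
      using \<open>path_image ?J \<inter> S \<subseteq> {z}\<close> \<open>z \<in> S\<close> by auto
    show "2 * (\<tau>0 + \<tau>1) \<noteq> 0" using \<tau>0 \<tau>1 by simp
    \<comment> \<open>The second half of the joined path runs through the segment at double
      speed.\<close>
    have "((\<lambda>x. z + ((2 * x - 1) * (\<tau>0 + \<tau>1) - \<tau>1) *\<^sub>R d) has_vector_derivative (2 * (\<tau>0 + \<tau>1)) *\<^sub>R d) (at ?r)"
      by (auto intro!: derivative_eq_intros)
    then show "(?J has_vector_derivative (2 * (\<tau>0 + \<tau>1)) *\<^sub>R d) (at ?r)"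
    proof (rule has_vector_derivative_transform_within_open[of _ _ _ "{1/2<..}"])
      fix x :: real assume "x \<in> {1/2<..}"
      then show "z + ((2 * x - 1) * (\<tau>0 + \<tau>1) - \<tau>1) *\<^sub>R d = ?J x"
        using line[of "2 * x - 1"] by (simp add: joinpaths_def)
    qed (use \<rho> in auto)
  qed
qed

text \<open>In the coordinates of the basis \<open>v\<close>, \<open>w\<close> every multiple of
  \<open>v + w\<close> has equal coordinates, while those of \<open>v\<close> and those of
  \<open>w\<close> differ.\<close>

lemma not_collinear_sum:
  fixes v w :: complex
  assumes "\<not> collinear {0, v, w}" "\<kappa> \<noteq> 0"
  shows "\<not> collinear {0, \<kappa> *\<^sub>R (v + w), v}" "\<not> collinear {0, \<kappa> *\<^sub>R (v + w), w}"
proof -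
  obtain \<alpha> \<beta> :: "complex \<Rightarrow> real" where lin: "bounded_linear \<alpha>" "bounded_linear \<beta>"
    and co: "\<alpha> v = 1" "\<beta> v = 0" "\<alpha> w = 0" "\<beta> w = 1"
    using plane_coordinates[OF assms(1)] .
  interpret \<alpha>: bounded_linear \<alpha> by fact
  interpret \<beta>: bounded_linear \<beta> by fact
  have "v \<noteq> 0" "w \<noteq> 0" using co \<alpha>.zero \<beta>.zero by force+
  have s: "\<alpha> (\<kappa> *\<^sub>R (v + w)) = \<kappa>" "\<beta> (\<kappa> *\<^sub>R (v + w)) = \<kappa>"
    by (simp_all add: \<alpha>.scaleR \<beta>.scaleR \<alpha>.add \<beta>.add co)
  have n: "\<kappa> *\<^sub>R (v + w) \<noteq> 0" using s(1) \<open>\<kappa> \<noteq> 0\<close> \<alpha>.zero by force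
  have "v \<noteq> c *\<^sub>R (\<kappa> *\<^sub>R (v + w))" for c
  proof
    assume e: "v = c *\<^sub>R (\<kappa> *\<^sub>R (v + w))"
    have "\<alpha> v = \<beta> v"
      by (subst e, subst (2) e) (simp only: \<alpha>.scaleR[of c] \<beta>.scaleR[of c] s)
    then show False using co by simp
  qed
  then show "\<not> collinear {0, \<kappa> *\<^sub>R (v + w), v}"
    using n \<open>v \<noteq> 0\<close> by (auto simp: collinear_lemma)
  have "w \<noteq> c *\<^sub>R (\<kappa> *\<^sub>R (v + w))" for c
  proof
    assume e: "w = c *\<^sub>R (\<kappa> *\<^sub>R (v + w))"
    have "\<alpha> w = \<beta> w"
      by (subst e, subst (2) e) (simp only: \<alpha>.scaleR[of c] \<beta>.scaleR[of c] s)
    then show False using co by simp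
  qed
  then show "\<not> collinear {0, \<kappa> *\<^sub>R (v + w), w}"
    using n \<open>w \<noteq> 0\<close> by (auto simp: collinear_lemma)
qed

lemma shadow_periodic:
  assumes "knot K" "s - t \<in> \<int>"
  shows "shadow K s = shadow K t"
  using assms by (metis knot_def shadow_def)

lemma shadow_derivative_periodic:
  assumes "knot K" "s - t \<in> \<int>" "(shadow K has_vector_derivative v) (at s)"
  shows "(shadow K has_vector_derivative v) (at t)"
proof -
  have "((\<lambda>r. r + (s - t)) has_vector_derivative 1) (at t)"
    by (auto intro!: derivative_eq_intros)
  moreover have "(shadow K has_vector_derivative v) (at (t + (s - t)))" using assms(3) by simp
  ultimately have "(shadow K \<circ> (\<lambda>r. r + (s - t)) has_vector_derivative (1::real) *\<^sub>R v) (at t)"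
    by (rule vector_diff_chain_at)
  moreover have "shadow K \<circ> (\<lambda>r. r + (s - t)) = shadow K"
    using assms by (auto intro!: ext shadow_periodic)
  ultimately show ?thesis by simp
qed

lemma shadow_continuous: "knot K \<Longrightarrow> continuous_on S (shadow K)"
  unfolding knot_def shadow_def by (intro continuous_intros) (metis continuous_on_subset subset_UNIV)

text \<open>The kink and the rest of the diagram meet only in the crossing and neither of them separates the
  sectors at \<open>v + w\<close> and \<open>- v - w\<close>, so by Janiszewski's theorem their union does not either.\<close>

lemma nugatory_if_kink:
  assumes K: "knot K" and reg: "regular_projection K"
    and st: "s < t" "t < s + 1" "shadow K s = shadow K t"
    and simple: "\<And>r. s < r \<Longrightarrow> r < t \<Longrightarrow> r \<notin> crossing_params K"
  shows "nugatory K (shadow K s)"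
proof -
  let ?g = "shadow K"
  define z where "z = ?g s"
  have non_int: "x - y \<notin> \<int>" if "y < x" "x < y + 1" for x y :: real
    using Ints_nonzero_abs_less1[of "x - y"] that by auto
  obtain v w where v: "(?g has_vector_derivative v) (at s)" and w: "(?g has_vector_derivative w) (at t)"
    and indep: "\<not> collinear {0, v, w}"
    using reg st non_int[of s t] unfolding regular_projection_def by (metis minus_diff_eq Ints_minus)
  have z: "?g s = z" "?g t = z" "?g (s + 1) = z"
    using st shadow_periodic[OF K, of "s + 1" s] by (simp_all add: z_def)
  have v': "(?g has_vector_derivative v) (at (s + 1))"
    using shadow_derivative_periodic[OF K, of s "s + 1"] v by simp
  \<comment> \<open>\<open>s\<close> and \<open>t\<close> already account for both strands at
    \<open>z\<close>, as triple points are excluded.\<close>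
  have at_z: "r - s \<in> \<int> \<or> r - t \<in> \<int>" if "?g r = z" for r
    using reg that z non_int[of s t] st unfolding regular_projection_def
    by (metis Ints_minus minus_diff_eq)
  have loop1: "?g r \<noteq> z" if "s < r" "r < t" for r
    using at_z[of r] non_int[of s r] non_int[of r t] that st Ints_minus[of "r - t"] by force
  have loop2: "?g r \<noteq> z" if "t < r" "r < s + 1" for r
    using at_z[of r] non_int[of s r] non_int[of t r] that st by force
  obtain \<eta>1 where \<eta>1: "\<eta>1 > 0" "\<And>\<epsilon>. 0 < \<epsilon> \<Longrightarrow> \<epsilon> < \<eta>1 \<Longrightarrow>
      connected_component (- ?g ` {s..t}) (z + \<epsilon> *\<^sub>R (v + w)) (z - \<epsilon> *\<^sub>R (v + w))"
    using loop_misses_opposite_sectors[OF st(1) shadow_continuous[OF K] z(1,2) loop1 v w indep] by blast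
  \<comment> \<open>The rest of the diagram leaves \<open>z\<close> along \<open>w\<close> and
    returns along \<open>v\<close>, so the roles of \<open>v\<close> and \<open>w\<close> are
    exchanged.\<close>
  have "\<not> collinear {0, w, v}" using indep by (simp add: insert_commute)
  then obtain \<eta>2 where \<eta>2: "\<eta>2 > 0" "\<And>\<epsilon>. 0 < \<epsilon> \<Longrightarrow> \<epsilon> < \<eta>2 \<Longrightarrow>
      connected_component (- ?g ` {t..s + 1}) (z + \<epsilon> *\<^sub>R (v + w)) (z - \<epsilon> *\<^sub>R (v + w))"
    using loop_misses_opposite_sectors[OF st(2) shadow_continuous[OF K] z(2,3) loop2 w v']
    by (metis add.commute)
  define \<epsilon> where "\<epsilon> = min \<eta>1 \<eta>2 / 2"
  have \<epsilon>: "0 < \<epsilon>" "\<epsilon> < \<eta>1" "\<epsilon> < \<eta>2" using \<eta>1(1) \<eta>2(1) by (auto simp: \<epsilon>_def min_def)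
  have range: "range ?g = ?g ` {s..t} \<union> ?g ` {t..s + 1}"
  proof (intro equalityI subsetI)
    fix x assume "x \<in> range ?g"
    then obtain r where r: "x = ?g r" by auto
    let ?r = "r - of_int \<lfloor>r - s\<rfloor>"
    have "s \<le> ?r" "?r \<le> s + 1" by linarith+
    moreover have "?g ?r = x" unfolding r by (rule shadow_periodic[OF K]) simp
    ultimately show "x \<in> ?g ` {s..t} \<union> ?g ` {t..s + 1}"
      by (cases "?r \<le> t") (auto intro!: image_eqI[of _ _ ?r])
  qed auto
  have inter: "?g ` {s..t} \<inter> ?g ` {t..s + 1} = {z}"
  proof (intro equalityI subsetI)
    fix x assume "x \<in> ?g ` {s..t} \<inter> ?g ` {t..s + 1}"
    then obtain a b where ab: "s \<le> a" "a \<le> t" "t \<le> b" "b \<le> s + 1" "x = ?g a" "?g b = ?g a" by auto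
    \<comment> \<open>A passage of the rest of the diagram through an interior point of the kink
      would be a crossing inside the kink.\<close>
    have False if "s < a" "a < t"
      using simple[OF that] non_int[of a b] that ab unfolding crossing_params_def by force
    then show "x \<in> {z}" using ab z by force
  qed (use z st in \<open>auto intro: image_eqI[of _ _ t]\<close>)
  have "connected_component (- range ?g) (z + \<epsilon> *\<^sub>R (v + w)) (z - \<epsilon> *\<^sub>R (v + w))"
    unfolding range using \<epsilon> \<eta>1(2) \<eta>2(2) inter
    by (intro Janiszewski)
       (auto intro!: compact_continuous_image compact_imp_closed shadow_continuous[OF K])
  moreover have "closed (range ?g)"
    unfolding range by (intro closed_Un compact_imp_closed compact_continuous_image shadow_continuous[OF K]) auto
  \<comment> \<open>Points of the gap are end points of the connections of size
    \<open>\<bar>\<tau>\<bar>\<close>, hence avoid the diagram.\<close>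
  moreover have "z + \<tau> *\<^sub>R (v + w) \<notin> range ?g" if "\<tau> \<noteq> 0" "\<bar>\<tau>\<bar> \<le> \<epsilon>" for \<tau>
  proof -
    have "z + \<bar>\<tau>\<bar> *\<^sub>R (v + w) \<notin> range ?g" "z - \<bar>\<tau>\<bar> *\<^sub>R (v + w) \<notin> range ?g"
      unfolding range using \<eta>1(2)[of "\<bar>\<tau>\<bar>"] \<eta>2(2)[of "\<bar>\<tau>\<bar>"] \<epsilon> that connected_component_in by fastforce+
    then show ?thesis by (cases "\<tau> \<ge> 0") auto
  qed
  moreover have "v + w \<noteq> 0"
    using not_collinear_sum(1)[OF indep, of 1] by auto
  moreover have "z \<in> range ?g" using z by blast
  ultimately obtain J r \<kappa> where J: "simple_path J" "pathfinish J = pathstart J"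
    "path_image J \<inter> range ?g = {z}" "0 < r" "r < 1" "J r = z"
    "\<kappa> \<noteq> 0" "(J has_vector_derivative \<kappa> *\<^sub>R (v + w)) (at r)"
    using closed_loop_through_gap[of "range ?g" z "v + w" \<epsilon>] \<epsilon>(1) by metis
  \<comment> \<open>Every strand through \<open>z\<close> has tangent \<open>v\<close> or
    \<open>w\<close>, and the curve crosses it in the direction of \<open>v + w\<close>.\<close>
  have "\<not> collinear {0, \<kappa> *\<^sub>R (v + w), u}"
    if "?g r = z" "(?g has_vector_derivative u) (at r)" for r u
    using at_z[OF that(1)]
  proof
    assume "r - s \<in> \<int>"
    then have "u = v"
      using shadow_derivative_periodic[OF K _ that(2)] v vector_derivative_unique_at by blast
    then show ?thesis using not_collinear_sum(1)[OF indep J(7)] by simp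
  next
    assume "r - t \<in> \<int>"
    then have "u = w"
      using shadow_derivative_periodic[OF K _ that(2)] w vector_derivative_unique_at by blast
    then show ?thesis using not_collinear_sum(2)[OF indep J(7)] by simp
  qed
  then have "nugatory K z"
    unfolding nugatory_def using J by blast
  then show ?thesis by (simp add: z_def)
qed

section \<open>Alternating diagrams\<close>

lemma eq_if_diff_Ints_less_1:
  fixes s t :: real
  assumes "s - t \<in> \<int>" "\<bar>s - t\<bar> < 1"
  shows "s = t"
  using Ints_nonzero_abs_less1[OF assms] by simp

locale alternating_diagram =
  fixes K :: "real \<Rightarrow> space"
  assumes knot: "knot K" and regular: "regular_projection K" and alternating: "alternating K"
    and crossings_pos: "num_crossings K > 0"
begin

abbreviation n :: nat where "n \<equiv> num_crossings K"

abbreviation up :: "nat \<Rightarrow> real" where "up \<equiv> under_param K"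

section \<open>Periodicity and the types of crossing parameters\<close>

lemma K_eq_iff: "K s = K t \<longleftrightarrow> s - t \<in> \<int>"
  using knot by (simp add: knot_def)

lemma shadow_add_int [simp]: "shadow K (t + of_int m) = shadow K t"
  by (rule shadow_periodic[OF knot]) simp

lemma height_add_int [simp]: "height K (t + of_int m) = height K t"
  using K_eq_iff[of "t + of_int m" t] by (simp add: height_def)

lemma under_params_add_int: "t + of_int m \<in> under_params K \<longleftrightarrow> t \<in> under_params K"
  by (simp add: under_params_def)

lemma over_params_add_int: "t + of_int m \<in> over_params K \<longleftrightarrow> t \<in> over_params K"
  by (simp add: over_params_def)

lemma crossing_params_add_int:
  assumes "t \<in> crossing_params K"
  shows "t + of_int m \<in> crossing_params K"
proof -
  obtain s where s: "s - t \<notin> \<int>" "shadow K s = shadow K t"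
    using assms by (auto simp: crossing_params_def)
  then have "(s + of_int m) - (t + of_int m) \<notin> \<int>" "shadow K (s + of_int m) = shadow K (t + of_int m)" by simp_all
  then show ?thesis unfolding crossing_params_def by blast
qed

lemma not_int_if_height_neq: "height K s \<noteq> height K t \<Longrightarrow> s - t \<notin> \<int>"
  using K_eq_iff[of s t] by (auto simp: height_def)

lemma double_points:
  "shadow K r = shadow K s \<Longrightarrow> shadow K s = shadow K t \<Longrightarrow> r - s \<in> \<int> \<or> s - t \<in> \<int> \<or> r - t \<in> \<int>"
  using regular unfolding regular_projection_def by blast

text \<open>The knot is injective modulo its period, so two strands over one point have different
  heights.\<close>

lemma crossing_params_eq: "crossing_params K = under_params K \<union> over_params K"
proof (intro equalityI subsetI)
  fix t assume "t \<in> crossing_params K"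
  then obtain s where s: "s - t \<notin> \<int>" "shadow K s = shadow K t"
    by (auto simp: crossing_params_def)
  then have "height K s \<noteq> height K t"
    using K_eq_iff[of s t] by (auto simp: shadow_def height_def prod_eq_iff)
  then show "t \<in> under_params K \<union> over_params K"
    using s(2) by (auto simp: under_params_def over_params_def neq_iff)
next
  fix t assume "t \<in> under_params K \<union> over_params K"
  then obtain s where "shadow K s = shadow K t" "height K s \<noteq> height K t"
    by (auto simp: under_params_def over_params_def)
  then show "t \<in> crossing_params K"
    using not_int_if_height_neq unfolding crossing_params_def by blast
qed

text \<open>A parameter of both kinds would give a triple point.\<close>

lemma under_over_disjoint: "t \<in> under_params K \<Longrightarrow> t \<notin> over_params K"
proof
  assume "t \<in> under_params K" "t \<in> over_params K"
  then obtain r s where "shadow K r = shadow K t" "height K t < height K r"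
    "shadow K s = shadow K t" "height K s < height K t"
    by (auto simp: under_params_def over_params_def)
  moreover have "r - t \<notin> \<int>" "t - s \<notin> \<int>" "r - s \<notin> \<int>"
    using calculation by (auto intro!: not_int_if_height_neq)
  ultimately show False using double_points[of r t s] by metis
qed

lemma finite_crossings: "finite (crossing_params K \<inter> {s<..<s + 1})"
proof (rule finite_imageD)
  have "frac ` (crossing_params K \<inter> {s<..<s + 1}) \<subseteq> crossing_params K \<inter> {0..<1}"
  proof
    fix y assume "y \<in> frac ` (crossing_params K \<inter> {s<..<s + 1})"
    then obtain x where x: "x \<in> crossing_params K" "y = frac x" by blast
    have "frac x \<in> crossing_params K"
      using crossing_params_add_int[OF x(1), of "- \<lfloor>x\<rfloor>"] by (simp add: frac_def)
    then show "y \<in> crossing_params K \<inter> {0..<1}" using x(2) by (simp add: frac_lt_1)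
  qed
  then show "finite (frac ` (crossing_params K \<inter> {s<..<s + 1}))"
    using regular finite_subset unfolding regular_projection_def by blast
  show "inj_on frac (crossing_params K \<inter> {s<..<s + 1})"
  proof
    fix x y assume xy: "x \<in> crossing_params K \<inter> {s<..<s + 1}" "y \<in> crossing_params K \<inter> {s<..<s + 1}" "frac x = frac y"
    then have "x - y = of_int (\<lfloor>x\<rfloor> - \<lfloor>y\<rfloor>)" by (simp add: frac_def)
    then have "x - y \<in> \<int>" by (metis Ints_of_int)
    then show "x = y" using xy by (intro eq_if_diff_Ints_less_1) auto
  qed
qed

section \<open>Undercrossings in order along the knot\<close>

abbreviation U :: "real set" where "U \<equiv> under_params K \<inter> {0..<1}"

lemma finite_U: "finite U"
  using crossings_pos unfolding num_crossings_def by (rule card_ge_0_finite)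

lemma up_less_n:
  assumes "i < n"
  shows "up i \<in> U" "up i = sorted_list_of_set U ! i"
proof -
  show "up i = sorted_list_of_set U ! i" using assms by (simp add: under_param_def)
  also have "\<dots> \<in> set (sorted_list_of_set U)"
    using assms by (intro nth_mem) (simp add: num_crossings_def)
  finally show "up i \<in> U" using finite_U by simp
qed

lemma up_decompose: "up i = up (i mod n) + real (i div n)"
  using crossings_pos by (simp add: under_param_def)

lemma up_add_n: "up (i + n) = up i + 1"
  using crossings_pos by (simp add: under_param_def)

lemma strict_mono_up: "strict_mono up"
proof (rule strict_monoI_Suc)
  fix i
  have r: "i mod n < n" using crossings_pos by simp
  show "up i < up (Suc i)"
  proof (cases "Suc (i mod n) < n")
    case True
    then have "up (i mod n) < up (Suc (i mod n))"
      using r up_less_n(2) sorted_wrt_nth_less[OF strict_sorted_list_of_set[of U], of "i mod n" "Suc (i mod n)"]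
      by (simp add: num_crossings_def)
    then show ?thesis
      using True up_decompose[of i] up_decompose[of "Suc i"] by (simp add: mod_Suc div_Suc)
  next
    case False
    then have "Suc (i mod n) = n" using r by simp
    moreover have "up (i mod n) < 1" "0 \<le> up 0" using up_less_n(1) r crossings_pos by auto
    ultimately show ?thesis
      using up_decompose[of i] up_decompose[of "Suc i"] by (simp add: mod_Suc div_Suc)
  qed
qed

lemma up_nonneg: "up i \<ge> 0"
  using up_decompose[of i] up_less_n(1)[of "i mod n"] crossings_pos by simp

lemma up_under: "up i \<in> under_params K"
  using up_decompose[of i] up_less_n(1)[of "i mod n"] crossings_pos
    under_params_add_int[of "up (i mod n)" "int (i div n)"] by simp

lemma under_is_up:
  assumes "t \<in> under_params K" "t \<ge> 0"
  obtains j where "t = up j"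
proof -
  have "t - of_int \<lfloor>t\<rfloor> \<in> U"
    using under_params_add_int[of t "- \<lfloor>t\<rfloor>"] assms by (auto; linarith)
  then have "t - of_int \<lfloor>t\<rfloor> \<in> set (sorted_list_of_set U)" using finite_U by simp
  then obtain j where j: "j < n" "t - of_int \<lfloor>t\<rfloor> = sorted_list_of_set U ! j"
    by (auto simp: in_set_conv_nth num_crossings_def)
  have "up (j + nat \<lfloor>t\<rfloor> * n) = up j + real (nat \<lfloor>t\<rfloor>)"
    using up_decompose[of "j + nat \<lfloor>t\<rfloor> * n"] j(1) by simp
  then show ?thesis using that[of "j + nat \<lfloor>t\<rfloor> * n"] up_less_n(2)[OF j(1)] j(2) assms(2) by simp
qed

lemma no_under_between: "up i < t \<Longrightarrow> t < up (Suc i) \<Longrightarrow> t \<notin> under_params K"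
proof
  assume t: "up i < t" "t < up (Suc i)" "t \<in> under_params K"
  have "t \<ge> 0" using t(1) up_nonneg[of i] by simp
  then obtain j where "t = up j" using under_is_up t(3) by blast
  then have "i < j" "j < Suc i" using t strict_mono_less[OF strict_mono_up] by auto
  then show False by simp
qed

lemma up_Suc_le: "up (Suc i) \<le> up i + 1"
  using strict_mono_less_eq[OF strict_mono_up, of "Suc i" "i + n"] crossings_pos up_add_n[of i] by simp

text \<open>Here alternation enters: the first crossing after \<open>s\<close> would have to be an
  undercrossing, but an arc has none in its interior.\<close>

lemma no_two_over_between:
  assumes "up i < s" "s < t" "t < up (Suc i)" "s \<in> over_params K" "t \<in> over_params K"
  shows False
proof -
  \<comment> \<open>The right end is included so that the set contains \<open>t\<close> and has a
    minimum.\<close>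
  let ?C = "crossing_params K \<inter> {s<..t}"
  have "finite ?C"
    by (rule finite_subset[OF _ finite_crossings[of s]]) (use assms up_Suc_le[of i] in auto)
  moreover have "t \<in> ?C" using assms by (simp add: crossing_params_eq)
  ultimately have "Min ?C \<in> ?C" and min: "\<And>r. r \<in> ?C \<Longrightarrow> Min ?C \<le> r"
    using Min_in[of ?C] Min_le[of ?C] by blast+
  define m where "m = Min ?C"
  have m: "m \<in> crossing_params K" "s < m" "m \<le> t" "\<And>r. r \<in> ?C \<Longrightarrow> m \<le> r"
    using \<open>Min ?C \<in> ?C\<close> min unfolding m_def[symmetric] by (simp_all only: Int_iff greaterThanAtMost_iff)
  have "crossing_params K \<inter> {s<..<m} = {}" using m by force
  then have "s \<in> under_params K \<longleftrightarrow> m \<in> over_params K"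
    using alternating assms(4) m unfolding alternating_def by (metis UnCI crossing_params_eq)
  moreover have "m \<notin> under_params K" using no_under_between[of i m] m assms by auto
  ultimately show False using m(1) assms(4) under_over_disjoint crossing_params_eq by blast
qed

section \<open>Over arcs in an alternating diagram\<close>

lemma over_param:
  "over_param K i \<in> {0..<1}" "shadow K (over_param K i) = shadow K (up i)"
  "height K (up i) < height K (over_param K i)"
proof -
  let ?P = "\<lambda>s. s \<in> {0..<1} \<and> shadow K s = shadow K (up i) \<and> height K (up i) < height K s"
  obtain s where s: "shadow K s = shadow K (up i)" "height K (up i) < height K s"
    using up_under[of i] by (auto simp: under_params_def)
  let ?s = "s + of_int (- \<lfloor>s\<rfloor>)"
  have "?P ?s" unfolding shadow_add_int height_add_int using s by (auto; linarith)
  \<comment> \<open>Two different overpasses above one undercrossing would make a triple point, so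
    the description in \<open>over_param\<close> is unambiguous.\<close>
  moreover have "r = r'" if "?P r" "?P r'" for r r'
  proof -
    have "r - up i \<notin> \<int>" "up i - r' \<notin> \<int>" using that by (auto intro!: not_int_if_height_neq)
    then have "r - r' \<in> \<int>" using double_points[of r "up i" r'] that by metis
    then show ?thesis using that by (intro eq_if_diff_Ints_less_1) auto
  qed
  ultimately have "\<exists>!s. ?P s" by blast
  from theI'[OF this] show "over_param K i \<in> {0..<1}" "shadow K (over_param K i) = shadow K (up i)"
    "height K (up i) < height K (over_param K i)"
    unfolding over_param_def by auto
qed

lemma over_param_over: "over_param K i \<in> over_params K"
  using over_param[of i] unfolding over_params_def by auto

lemma locate:
  assumes "t \<notin> under_params K"
  obtains j m where "j < n" "up j < t + of_int m" "t + of_int m < up (Suc j)"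
proof -
  \<comment> \<open>Shifts \<open>t\<close> into the period that starts at
    \<open>up 0\<close>.\<close>
  define m where "m = - \<lfloor>t - up 0\<rfloor>"
  have m: "up 0 \<le> t + of_int m" "t + of_int m < up n"
    using up_add_n[of 0] unfolding m_def by (simp_all; linarith)+
  define k where "k = (LEAST k. t + of_int m < up k)"
  have k: "t + of_int m < up k" "k \<le> n"
    unfolding k_def using m(2) by (rule LeastI, rule Least_le)
  then have "k \<noteq> 0" using m(1) by (metis not_le)
  then obtain j where j: "k = Suc j" by (cases k) auto
  then have "\<not> t + of_int m < up j" using not_less_Least[of j "\<lambda>k. t + of_int m < up k"] unfolding k_def[symmetric] j by simp
  moreover have "t + of_int m \<noteq> up j" using up_under[of j] assms under_params_add_int by metis
  ultimately show ?thesis using that[of j m] k j by simp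
qed

text \<open>Arcs 0 to \<open>n - 1\<close> lie within the single period from \<open>up 0\<close> to
  \<open>up 0 + 1\<close>, so the integer \<open>t - t'\<close> has to vanish.\<close>

lemma locate_unique:
  assumes "j < n" "up j < t" "t < up (Suc j)" "j' < n" "up j' < t'" "t' < up (Suc j')" "t - t' \<in> \<int>"
  shows "j = j'" "t = t'"
proof -
  have le: "up i \<le> up k \<longleftrightarrow> i \<le> k" for i k by (rule strict_mono_less_eq[OF strict_mono_up])
  have "up 0 \<le> up j" "up 0 \<le> up j'" "up (Suc j) \<le> up (0 + n)" "up (Suc j') \<le> up (0 + n)"
    using assms by (simp_all add: le)
  then show "t = t'" using assms up_add_n[of 0] by (intro eq_if_diff_Ints_less_1) auto
  then have "\<not> up (Suc j) \<le> up j'" "\<not> up (Suc j') \<le> up j" using assms by auto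
  then show "j = j'" by (simp add: le)
qed

text \<open>Arcs are sets of points in space. By injectivity modulo the period, membership of the
  overpass determines a parameter interval, which makes the description in \<open>over_arc\<close>
  unambiguous.\<close>

lemma over_arc:
  obtains m where "over_arc K i < n" "up (over_arc K i) < over_param K i + of_int m"
    "over_param K i + of_int m < up (Suc (over_arc K i))"
proof -
  let ?o = "over_param K i"
  have "?o \<notin> under_params K" using over_param_over under_over_disjoint by blast
  then obtain j m where jm: "j < n" "up j < ?o + of_int m" "?o + of_int m < up (Suc j)"
    using locate by blast
  have arc: "\<exists>l. up k < ?o + of_int l \<and> ?o + of_int l < up (Suc k)" if "K ?o \<in> diagram_arc K k" for k
  proof -
    obtain t where t: "up k < t" "t < up (Suc k)" "t - ?o \<in> \<int>"
      using \<open>K ?o \<in> diagram_arc K k\<close> K_eq_iff[of _ ?o] by (force simp: diagram_arc_def)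
    then obtain l where "t - ?o = of_int l" by (auto elim: Ints_cases)
    then have "t = ?o + of_int l" by simp
    then show ?thesis using t by blast
  qed
  have "over_arc K i = j"
    unfolding over_arc_def
  proof (rule the_equality)
    have "K ?o = K (?o + of_int m)" by (simp add: K_eq_iff)
    then show "j < n \<and> K ?o \<in> diagram_arc K j" using jm by (auto simp: diagram_arc_def)
  next
    fix k assume k: "k < n \<and> K ?o \<in> diagram_arc K k"
    then obtain l where "up k < ?o + of_int l" "?o + of_int l < up (Suc k)" using arc by blast
    then show "k = j" using locate_unique(1)[of k "?o + of_int l" j "?o + of_int m"] jm k
      by (simp flip: of_int_diff)
  qed
  then show ?thesis using that jm by blast
qed

text \<open>An arc carries at most one overpass, and the double point there determines its
  undercrossing.\<close>

lemma over_arc_inj: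
  assumes "i < n" "k < n" "over_arc K i = over_arc K k"
  shows "i = k"
proof -
  let ?j = "over_arc K i"
  obtain m where m: "up ?j < over_param K i + of_int m" "over_param K i + of_int m < up (Suc ?j)"
    using over_arc by metis
  obtain l where l: "up ?j < over_param K k + of_int l" "over_param K k + of_int l < up (Suc ?j)"
    using over_arc assms(3) by metis
  have "over_param K i + of_int m = over_param K k + of_int l"
    using no_two_over_between[OF m(1) _ l(2)] no_two_over_between[OF l(1) _ m(2)]
    by (metis linorder_neqE_linordered_idom over_param_over over_params_add_int)
  then have "shadow K (over_param K i) = shadow K (over_param K k)"
    "height K (over_param K i) = height K (over_param K k)"
    by (metis shadow_add_int, metis height_add_int)
  then have sh: "shadow K (up i) = shadow K (over_param K i)" "shadow K (over_param K i) = shadow K (up k)"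
    and h: "height K (up i) < height K (over_param K i)" "height K (up k) < height K (over_param K i)"
    using over_param[of i] over_param[of k] by simp_all
  have "up i - over_param K i \<notin> \<int>" "over_param K i - up k \<notin> \<int>"
    using h by (auto intro!: not_int_if_height_neq)
  then have "up i - up k \<in> \<int>" using double_points[OF sh] by blast
  moreover have "\<bar>up i - up k\<bar> < 1" using up_less_n(1)[OF assms(1)] up_less_n(1)[OF assms(2)] by auto
  ultimately have "up i = up k" by (rule eq_if_diff_Ints_less_1)
  then show ?thesis using strict_mono_eq[OF strict_mono_up] by simp
qed

text \<open>The crossing \<open>k\<close> points to the two crossings where its over arc ends: the arc starts at
  undercrossing \<open>f k\<close> and stops at undercrossing \<open>g k\<close>.\<close>

definition f :: "nat \<Rightarrow> nat" where "f k = (if k < n then over_arc K k else k)"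

definition g :: "nat \<Rightarrow> nat" where "g k = (if k < n then Suc (over_arc K k) mod n else k)"

lemma over_arc_less: "over_arc K i < n"
  using over_arc by metis

lemma Suc_mod_eq_iff: "j < n \<Longrightarrow> i < n \<Longrightarrow> Suc j mod n = i \<longleftrightarrow> j = in_arc K i"
  unfolding in_arc_def by (cases i) (auto simp: mod_Suc)

lemma in_arc_less: "in_arc K i < n"
  using crossings_pos by (simp add: in_arc_def)

lemma f_permutes: "f permutes {..<n}"
proof (rule bij_imp_permutes)
  have "inj_on f {..<n}" by (auto simp: inj_on_def f_def intro: over_arc_inj)
  moreover have "f ` {..<n} \<subseteq> {..<n}" by (auto simp: f_def over_arc_less)
  ultimately show "bij_betw f {..<n} {..<n}" by (simp add: bij_betw_def endo_inj_surj)
qed (simp add: f_def)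

lemma g_permutes: "g permutes {..<n}"
proof (rule bij_imp_permutes)
  have gn: "g l < n" if "l < n" for l using that crossings_pos by (simp add: g_def)
  have "over_arc K l = in_arc K (g l)" if "l < n" for l
    using Suc_mod_eq_iff[OF over_arc_less[of l] gn[OF that]] that by (simp add: g_def)
  then have "inj_on g {..<n}"
    using over_arc_inj by (metis inj_onI lessThan_iff)
  moreover have "g ` {..<n} \<subseteq> {..<n}" using gn by auto
  ultimately show "bij_betw g {..<n} {..<n}" by (simp add: bij_betw_def endo_inj_surj)
qed (simp add: g_def)

text \<open>For \<open>s\<close> in a closed set \<open>S\<close>, surjectivity gives
  \<open>s = f k\<close> with \<open>k\<close> in \<open>S\<close>, and \<open>g k\<close> is the
  next undercrossing along the knot. So \<open>S\<close> is closed under the cyclic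
  successor.\<close>

sublocale permutation_digraph "{..<n}" f g
proof
  fix S assume S: "S \<subseteq> {..<n}" "S \<noteq> {}" "f ` S \<subseteq> S" "g ` S \<subseteq> S"
  have "inj_on f S" using f_permutes permutes_inj inj_on_subset by blast
  then have fS: "f ` S = S" using S(3) by (intro endo_inj_surj finite_subset[OF S(1) finite_lessThan])
  have step: "Suc s mod n \<in> S" if s: "s \<in> S" for s
  proof -
    obtain k where k: "k \<in> S" "s = f k" using fS s by blast
    then have "g k = Suc s mod n" using S(1) by (auto simp: f_def g_def)
    then show ?thesis using k S(4) by auto
  qed
  obtain s where s: "s \<in> S" using S by blast
  have "(s + i) mod n \<in> S" for i
  proof (induction i)
    case 0 then show ?case using s S(1) by auto
  next
    case (Suc i) then show ?case using step[of "(s + i) mod n"] by (simp add: mod_Suc_eq)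
  qed
  then have "(s + (n - s + i)) mod n \<in> S" for i by blast
  moreover have "(s + (n - s + i)) mod n = i" if "i < n" for i
  proof -
    have "s < n" using s S(1) by auto
    then have "s + (n - s + i) = n + i" by simp
    then show ?thesis using that by simp
  qed
  ultimately show "S = {..<n}" using S(1) by (metis lessThan_iff subsetI subset_antisym)
qed (use f_permutes g_permutes in auto)

text \<open>The over arc of \<open>k\<close> starts or stops at \<open>k\<close> itself. The strand
  between that undercrossing and the overpass is then a kink, since the overpass is the only
  crossing inside the arc.\<close>

lemma nugatory_if_fixed_point:
  assumes "k < n" "f k = k \<or> g k = k"
  obtains z where "z \<in> shadow K ` crossing_params K" "nugatory K z"
proof -
  obtain m where m: "up (over_arc K k) < over_param K k + of_int m"
    "over_param K k + of_int m < up (Suc (over_arc K k))" using over_arc by metis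
  let ?o = "over_param K k + of_int m" and ?j = "over_arc K k"
  have o: "?o \<in> over_params K" using over_param_over over_params_add_int by blast
  have no_crossing: "r \<notin> crossing_params K" if "up ?j < r" "r < up (Suc ?j)" "r \<noteq> ?o" for r
    using no_under_between[OF that(1,2)] no_two_over_between[OF that(1) _ m(2) _ o]
      no_two_over_between[OF m(1) _ that(2) o] that(3)
    by (auto simp: crossing_params_eq neq_iff)
  have sh: "shadow K ?o = shadow K (up k)" using over_param(2) by simp
  have le: "up (Suc ?j) \<le> up ?j + 1" by (rule up_Suc_le)
  have z: "shadow K (up k) \<in> shadow K ` crossing_params K"
    using up_under crossing_params_eq by blast
  from assms(2) show ?thesis
  proof
    assume "f k = k"
    then have "?j = k" using assms(1) by (simp add: f_def)
    then have "nugatory K (shadow K (up k))"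
      using m le sh no_crossing by (intro nugatory_if_kink[OF knot regular, of "up k" ?o]) auto
    then show ?thesis using that z by blast
  next
    assume "g k = k"
    then have j: "Suc ?j mod n = k" using assms(1) by (simp add: g_def)
    have "shadow K (up (Suc ?j)) = shadow K (up k)"
      using up_decompose[of "Suc ?j"] shadow_add_int[of "up k" "int (Suc ?j div n)"] j by simp
    then have "nugatory K (shadow K ?o)"
      using m le sh no_crossing by (intro nugatory_if_kink[OF knot regular, of ?o "up (Suc ?j)"]) auto
    then show ?thesis using that z sh by metis
  qed
qed

section \<open>The crossing matrix as a digraph Laplacian\<close>

definition entry :: "nat \<Rightarrow> nat \<Rightarrow> int" where
  "entry i j = 2 * of_bool (j = over_arc K i) - of_bool (j = i) - of_bool (j = in_arc K i)"

lemma sum_of_bool: "a < n \<Longrightarrow> (\<Sum>j<n. of_bool (j = a) * h j) = h a" for h :: "nat \<Rightarrow> int"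
  by (simp add: of_bool_def if_distrib[of "\<lambda>x. x * _"] cong: if_cong)

lemma entry_row:
  assumes "i < n"
  shows "(\<Sum>j<n. entry i j * h j) = 2 * h (over_arc K i) - h i - h (in_arc K i)"
  using sum_of_bool[OF over_arc_less, of i h] sum_of_bool[OF assms, of h] sum_of_bool[OF in_arc_less, of i h]
  by (simp add: entry_def left_diff_distrib sum_subtractf mult.assoc flip: sum_distrib_left)

text \<open>The arc \<open>f k\<close> passes over crossing \<open>k\<close> only and ends at the
  crossings \<open>f k\<close> and \<open>g k\<close>. Its column therefore is the row of the
  digraph Laplacian at \<open>k\<close>.\<close>

lemma entry_column:
  assumes "k < n"
  shows "(\<Sum>i<n. u i * entry i (f k)) = 2 * u k - u (f k) - u (g k)"
proof -
  have "entry i (f k) = 2 * of_bool (i = k) - of_bool (i = f k) - of_bool (i = g k)" if "i < n" for i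
  proof -
    have "f k = over_arc K i \<longleftrightarrow> i = k" using over_arc_inj that assms by (auto simp: f_def)
    moreover have "f k = in_arc K i \<longleftrightarrow> i = g k"
      using Suc_mod_eq_iff[OF over_arc_less that, of k] assms by (auto simp: f_def g_def)
    ultimately show ?thesis by (auto simp: entry_def)
  qed
  then have "(\<Sum>i<n. u i * entry i (f k)) =
      (\<Sum>i<n. (2 * of_bool (i = k) - of_bool (i = f k) - of_bool (i = g k)) * u i)"
    by (intro sum.cong) (simp_all add: mult.commute)
  moreover have "f k < n" "g k < n" using assms crossings_pos by (simp_all add: f_def g_def over_arc_less)
  ultimately show ?thesis
    using sum_of_bool[of k u] sum_of_bool[of "f k" u] sum_of_bool[of "g k" u] assms
    by (simp add: left_diff_distrib sum_subtractf mult.assoc flip: sum_distrib_left)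
qed

lemma crossing_matrix_minor:
  "mat_delete (crossing_matrix K) 0 0 = Matrix.mat (n - 1) (n - 1) (\<lambda>(i, j). entry (Suc i) (Suc j))"
  by (rule eq_matI) (auto simp: mat_delete_def crossing_matrix_def entry_def)

text \<open>The arc that stops at \<open>i\<close> passes over a single crossing, which is
  \<open>g' i\<close> by its end and \<open>f' (in_arc K i)\<close> by its index.\<close>

lemma g'_eq: "i < n \<Longrightarrow> g' i = f' (in_arc K i)"
proof -
  assume i: "i < n"
  let ?k = "f' (in_arc K i)"
  have fk: "f ?k = in_arc K i" using permutes_inverses[OF f_permutes] by simp
  have k: "?k < n" using permutes_in_image[OF permutes_inv[OF f_permutes]] in_arc_less by simp
  then have "g ?k = i" using Suc_mod_eq_iff[OF over_arc_less i, of ?k] fk by (simp add: f_def g_def)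
  then show ?thesis using permutes_inverses(2)[OF g_permutes, of ?k] by simp
qed

lemma prime_minor:
  assumes "prime p" "knot_det K = int p"
  shows "prime_minor n entry (int p)"
proof
  show "(\<Sum>j<n. entry i j) = 0" if "i < n" for i using entry_row[OF that, of "\<lambda>_. 1"] by simp
qed (use crossings_pos assms in \<open>auto simp: crossing_matrix_minor knot_det_def\<close>)

text \<open>The two kinds of coloring differ in labels only: arc \<open>j\<close> corresponds to the
  crossing \<open>f' j\<close> that it passes over.\<close>

lemma null_mod_iff_is_coloring:
  assumes "prime_minor n entry p"
  shows "prime_minor.null_mod n entry p (\<lambda>j. y (f' j)) \<longleftrightarrow> is_coloring p y"
proof -
  interpret pm: prime_minor n entry p by fact
  have "f' (over_arc K i) = i" if "i < n" for i
    using permutes_inverses(2)[OF f_permutes, of i] that by (simp add: f_def)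
  then show ?thesis by (auto simp: pm.null_mod_def entry_row is_coloring_def g'_eq)
qed

lemma distinct_colors:
  assumes "prime p" and det: "knot_det K = int p" and reduced: "reduced_diagram K"
    and c: "coloring p K c" "\<not> trivial_coloring K c"
    and AB: "A \<in> arcs K" "B \<in> arcs K" "A \<noteq> B"
  shows "c A \<noteq> c B"
proof
  assume "c A = c B"
  interpret pm: prime_minor n entry "int p" by (rule prime_minor) fact+
  define col where "col j = int (c (diagram_arc K j))" for j
  define x where "x k = col (f k)" for k
  have xf': "x (f' j) = col j" for j using permutes_inverses(1)[OF f_permutes] by (simp add: x_def)
  have "pm.null_mod col"
    using c(1) by (simp add: pm.null_mod_def entry_row col_def coloring_def cong_0_iff)
  then have x: "is_coloring (int p) x"
    using null_mod_iff_is_coloring[OF pm.prime_minor_axioms, of x] by (simp add: xf')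
  have arc: "\<exists>k<n. X = diagram_arc K (f k)" if "X \<in> arcs K" for X
  proof -
    obtain j where "j < n" "X = diagram_arc K j" using \<open>X \<in> arcs K\<close> crossings_pos by (auto simp: arcs_def)
    then show ?thesis using permutes_image[OF f_permutes] by (metis imageE lessThan_iff)
  qed
  obtain X Y where XY: "X \<in> arcs K" "Y \<in> arcs K" "c X \<noteq> c Y" using c(2) by (auto simp: trivial_coloring_def)
  then obtain a b where ab: "a < n" "b < n" "X = diagram_arc K a" "Y = diagram_arc K b"
    using crossings_pos by (auto simp: arcs_def)
  \<comment> \<open>Colors lie in \<open>{0..<p}\<close>, so distinct colors are incongruent modulo
    \<open>p\<close>.\<close>
  have "c X < p" "c Y < p" using c(1) XY by (auto simp: coloring_def)
  then have "\<not> int p dvd col a - col b"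
    using XY(3) ab zdvd_not_zless[of "\<bar>col a - col b\<bar>" "int p"] by (auto simp: col_def)
  note nonconst = \<open>pm.null_mod col\<close> ab(1,2) this
  obtain i j where ij: "i < n" "j < n" "A = diagram_arc K (f i)" "B = diagram_arc K (f j)"
    using arc AB by blast
  have unique: "\<exists>l \<mu>. \<forall>k\<in>{..<n}. int p dvd y k - (l * x k + \<mu>)" if "is_coloring (int p) y" for y
  proof -
    have "pm.null_mod (\<lambda>j. y (f' j))" using that null_mod_iff_is_coloring[OF pm.prime_minor_axioms] by simp
    from pm.null_mod_unique[OF nonconst(1) this nonconst(2-)]
    obtain l \<mu> where *: "\<And>k. k < n \<Longrightarrow> int p dvd y (f' k) - (l * col k + \<mu>)" by blast
    have "int p dvd y k - (l * x k + \<mu>)" if "k < n" for k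
      using *[of "f k"] that over_arc_less permutes_inverses(2)[OF f_permutes, of k]
      by (simp add: x_def f_def)
    then show ?thesis by blast
  qed
  have potential: "\<exists>u :: nat \<Rightarrow> int. \<forall>k\<in>{..<n}. 2 * u k - u (f k) - u (g k) = of_bool (k = i) - of_bool (k = j)"
    if "i \<in> {..<n}" "j \<in> {..<n}" "int p dvd x i - x j" for i j
  proof -
    \<comment> \<open>Difference of the unit vectors of two arcs; its pairing with the coloring is
      \<open>x i - x j\<close>, so that \<open>row_span\<close> applies.\<close>
    let ?y = "\<lambda>a. of_bool (a = f i) - of_bool (a = f j) :: int"
    have ij: "f i < n" "f j < n" using that by (simp_all add: f_def over_arc_less)
    have y: "(\<Sum>a<n. ?y a * h a) = h (f i) - h (f j)" for h
      using sum_of_bool[OF ij(1), of h] sum_of_bool[OF ij(2), of h] by (simp add: left_diff_distrib sum_subtractf)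
    have "\<exists>u. \<forall>a<n. (\<Sum>k<n. u k * entry k a) = ?y a"
      using pm.row_span[OF nonconst, of ?y] y[of "\<lambda>_. 1"] y[of col] that(3) by (simp add: x_def)
    then obtain u where u: "\<And>a. a < n \<Longrightarrow> (\<Sum>k<n. u k * entry k a) = ?y a" by blast
    have "2 * u k - u (f k) - u (g k) = of_bool (k = i) - of_bool (k = j)" if "k < n" for k
    proof -
      have "f k < n" using that by (simp add: f_def over_arc_less)
      from u[OF this] show ?thesis
        by (simp add: entry_column[OF that] inj_eq[OF permutes_inj[OF f_permutes]])
    qed
    then show ?thesis by (intro exI[of _ u] ballI) (simp only: lessThan_iff)
  qed
  have "x i = x j" using \<open>c A = c B\<close> unfolding ij x_def col_def by (simp only:)
  then have eq: "int p dvd x i - x j" by simp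
  have "i \<noteq> j" using AB(3) ij by blast
  have "prime (int p)" using \<open>prime p\<close> by simp
  obtain k where "k \<in> {..<n}" "f k = k \<or> g k = k"
    using fixed_point_of_equal_colors[OF x \<open>prime (int p)\<close> unique potential _ _ \<open>i \<noteq> j\<close> eq] ij(1,2)
    by (auto simp only: lessThan_iff)
  then have "k < n" "f k = k \<or> g k = k" by simp_all
  then obtain z where "z \<in> shadow K ` crossing_params K" "nugatory K z"
    by (rule nugatory_if_fixed_point)
  then show False using reduced by (auto simp: reduced_diagram_def)
qed

end

theorem mainTheorem1:
  fixes K :: "real \<Rightarrow> space" and p :: nat and c :: "space set \<Rightarrow> nat"
  assumes "knot K" and "regular_projection K"
    and "prime p" and "knot_det K = int p"
    and "reduced_diagram K" and "alternating K"
    and "coloring p K c" and "\<not> trivial_coloring K c"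
  shows "\<forall>A\<in>arcs K. \<forall>B\<in>arcs K. A \<noteq> B \<longrightarrow> c A \<noteq> c B"
proof (cases "num_crossings K = 0")
  case True
  \<comment> \<open>The whole knot is the only arc here, so no two distinct arcs have to be
    compared.\<close>
  then show ?thesis by (simp add: arcs_def)
next
  case False
  then interpret alternating_diagram K by unfold_locales (use assms in auto)
  show ?thesis using distinct_colors assms by blast
qed

end
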